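(* Let $q=2$, $F=\mathbb F_2(T)$, $A=\mathbb F_2[T]$, and let $\mathfrak p\triangleleft A$ be a prime ideal with $\deg(\mathfrak p)\geq3$. Let $\phi:A\to F\{\tau\}$ be a Drinfeld module of rank two which has good reduction at every place of $F$ different from $\infty$. Then $\phi$ does not have a $\mathrm{Gal}(\overline F|F)$-invariant cyclic $\mathfrak p$-torsion subgroup.
   Context: $\infty$ is the place of $F$ at infinity (corresponding to $1/T$). A Drinfeld module of rank two over $F$ is an $\mathbb F_2$-algebra homomorphism $\phi:A\to F\{\tau\}$ with $\phi(T)=T+g\tau+\Delta\tau^2$, $\Delta\neq0$; it has good reduction at a place $v$ if it is isomorphic over $F$ to one with $\phi(T)$ having coefficients $g$, $\Delta$ in the valuation ring $\mathcal O_v$ and $\Delta\in\mathcal O_v^*$. A cyclic $\mathfrak p$-torsion subgroup is an $A$-submodule of $\phi[\mathfrak p](\overline F)$ isomorphic to $A/\mathfrak p$ (a one-dimensional $A/\mathfrak p$-subspace), $\overline F$ being a separable closure of $F$. *)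

theory Defs
  imports "HOL-Library.Z2" "HOL-Computational_Algebra.Computational_Algebra"
begin

type_synonym A = "bit poly"
type_synonym F = "bit poly fract"

definition embA :: "A \<Rightarrow> F" where "embA a = Fract a 1"

definition Tvar :: A where "Tvar = [:0, 1:]"

text \<open>Valuation ring O_v at the finite place given by a monic irreducible w,
  i.e. the localisation of A at (w), and its units.\<close>
definition in_Ov :: "A \<Rightarrow> F \<Rightarrow> bool" where
  "in_Ov w x \<longleftrightarrow> (\<exists>a b. \<not> w dvd b \<and> x = Fract a b)"

definition unit_Ov :: "A \<Rightarrow> F \<Rightarrow> bool" where
  "unit_Ov w x \<longleftrightarrow> x \<noteq> 0 \<and> in_Ov w x \<and> in_Ov w (inverse x)"

text \<open>Rank two Drinfeld modules phi(T) = T + g tau + D tau^2 and psi(T) = T + g' tau + D' tau^2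
  are isomorphic over F iff there is c in F^* with c phi(T) = psi(T) c in F{tau};
  comparing coefficients (tau c = c^2 tau) this reads as below.\<close>
definition drinfeld_iso :: "F \<Rightarrow> F \<Rightarrow> F \<Rightarrow> F \<Rightarrow> bool" where
  "drinfeld_iso g D g' D' \<longleftrightarrow>
     (\<exists>c. c \<noteq> 0 \<and> c * embA Tvar = embA Tvar * c \<and> c * g = g' * c ^ 2 \<and> c * D = D' * c ^ 4)"

definition good_reduction_at :: "A \<Rightarrow> F \<Rightarrow> F \<Rightarrow> bool" where
  "good_reduction_at w g D \<longleftrightarrow>
     (\<exists>g' D'. D' \<noteq> 0 \<and> drinfeld_iso g D g' D' \<and> in_Ov w g' \<and> in_Ov w D' \<and> unit_Ov w D')"

definition is_field_hom :: "('a::field \<Rightarrow> 'b::field) \<Rightarrow> bool" where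
  "is_field_hom h \<longleftrightarrow> h 1 = 1 \<and> (\<forall>x y. h (x + y) = h x + h y) \<and> (\<forall>x y. h (x * y) = h x * h y)"

definition separable_closure :: "(F \<Rightarrow> 'k::field) \<Rightarrow> bool" where
  "separable_closure iota \<longleftrightarrow> is_field_hom iota \<and>
     (\<forall>x. \<exists>f :: F poly. f \<noteq> 0 \<and> coprime f (pderiv f) \<and> poly (map_poly iota f) x = 0) \<and>
     (\<forall>f :: 'k poly. degree f \<ge> 1 \<and> coprime f (pderiv f) \<longrightarrow> (\<exists>x. poly f x = 0))"

definition galois_elem :: "(F \<Rightarrow> 'k::field) \<Rightarrow> ('k \<Rightarrow> 'k) \<Rightarrow> bool" where
  "galois_elem iota \<sigma> \<longleftrightarrow> bij \<sigma> \<and> is_field_hom \<sigma> \<and> (\<forall>y. \<sigma> (iota y) = iota y)"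

definition phiT :: "(F \<Rightarrow> 'k::field) \<Rightarrow> F \<Rightarrow> F \<Rightarrow> 'k \<Rightarrow> 'k" where
  "phiT iota g D x = iota (embA Tvar) * x + iota g * x ^ 2 + iota D * x ^ 4"

definition phi :: "(F \<Rightarrow> 'k::field) \<Rightarrow> F \<Rightarrow> F \<Rightarrow> A \<Rightarrow> 'k \<Rightarrow> 'k" where
  "phi iota g D a x = (\<Sum>i\<le>degree a. iota (embA [:coeff a i:]) * (phiT iota g D ^^ i) x)"

definition torsion :: "(F \<Rightarrow> 'k::field) \<Rightarrow> F \<Rightarrow> F \<Rightarrow> A \<Rightarrow> 'k set" where
  "torsion iota g D p = {x. phi iota g D p x = 0}"

text \<open>H is a cyclic p-torsion subgroup: an A-submodule of phi[p] isomorphic to A/p, i.e.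
  the image of an A-linear map A -> K with kernel pA.\<close>
definition cyclic_torsion_subgroup :: "(F \<Rightarrow> 'k::field) \<Rightarrow> F \<Rightarrow> F \<Rightarrow> A \<Rightarrow> 'k set \<Rightarrow> bool" where
  "cyclic_torsion_subgroup iota g D p H \<longleftrightarrow> H \<subseteq> torsion iota g D p \<and>
     (\<exists>f :: A \<Rightarrow> 'k. (\<forall>a b. f (a + b) = f a + f b) \<and> (\<forall>a b. f (a * b) = phi iota g D a (f b))
        \<and> range f = H \<and> (\<forall>a. f a = 0 \<longleftrightarrow> p dvd a))"

end

theory Submission
  imports Defs
begin

text \<open>Good reduction at all finite places and the triviality of the units of A allow one to assume
  that the leading coefficient D is 1 and that g is a polynomial. Let H be a stable cyclic torsion
  subgroup, with generator f, and let t be a root of p in K. Projecting the A/p-module H tensored with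
  K to the eigenlines on which the variable acts by t, t^2 and t^4 gives elements r0, r1, r2 of K with
  (T + t^4) r2 = g r1^2 + r0^4. The Galois group acts on H through a character, so q = r1 / r0^2
  is fixed by the automorphisms fixing t and an automorphism with t \<mapsto> t^2 maps it to r2 / r1^2. Hence q is a
  rational function of T with coefficients in the finite field of t, and, with s = t^2 and q'
  obtained from q by squaring the coefficients, (T + s^2) q' q^2 = g q^2 + 1. Clearing denominators
  and comparing degrees after differentiating, where squares have derivative zero in
  characteristic 2, forces s to lie in the prime field. But then p has degree 1.\<close>

section \<open>Polynomials over a field of characteristic two\<close>

text \<open>No tensor product is formed: with y_j the image of the generator under T^j, the sequence
  y becomes the linear functional x^j |-> y_j on K[x], which kills the multiples of p. The three
  eigenvectors are the cofactors p/(x+t), p/(x+t^2) and p/(x+t^4), each obtained from the previous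
  one by squaring coefficients. The root t is not arbitrary: it is selected so that r0 is nonzero.
  An automorphism fixing t acts through some \<chi> in F_2[x], so it multiplies r0 by \<chi>(t) and
  r1 by \<chi>(t^2) = \<chi>(t)^2, which cancels in q. The equation for q is the relation among the
  r_i divided by r0^4, since r2 / r0^4 = q' q^2. The obstacle is that q involves the constants
  F_2(t), so the equation mixes q with its twist q'; differentiation helps because it commutes with
  twisting and kills squares.\<close>

definition frob_poly :: "'a::comm_semiring_1 poly \<Rightarrow> 'a poly" where
  "frob_poly = map_poly (\<lambda>x. x ^ 2)"

locale char2_field =
  fixes type_of_field :: "'a::field itself"
  assumes two_eq_0: "(2::'a) = 0"
begin

declare two_eq_0 [simp]

lemma poly_two_eq_0 [simp]: "(2::'a poly) = 0"
proof -
  have "(2::'a poly) = [:2:]" by (simp add: numeral_poly)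
  then show ?thesis by simp
qed

lemma add_self [simp]: "(x::'a) + x = 0"
  by (simp flip: mult_2)

lemma poly_add_self [simp]: "(p::'a poly) + p = 0"
  by (simp flip: mult_2)

lemma add_eq_0_iff_eq: "(x::'a) + y = 0 \<longleftrightarrow> x = y"
  by (metis add_self add_right_cancel)

lemma poly_add_eq_0_iff_eq: "(p::'a poly) + q = 0 \<longleftrightarrow> p = q"
  by (metis poly_add_self add_right_cancel)

lemma square_add: "((x::'a) + y)^2 = x^2 + y^2"
  by (simp add: power2_sum two_eq_0)

lemma square_add_poly: "((p::'a poly) + q)^2 = p^2 + q^2"
proof -
  have "(p + q)^2 = p^2 + q^2 + (p * q + p * q)"
    by (simp add: power2_eq_square algebra_simps)
  then show ?thesis by simp
qed

lemma square_inj: "(x::'a)^2 = y^2 \<Longrightarrow> x = y"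
  by (metis add_eq_0_iff_eq square_add zero_eq_power2)

lemma square_inj_poly: "(p::'a poly)^2 = q^2 \<Longrightarrow> p = q"
  by (metis poly_add_eq_0_iff_eq square_add_poly zero_eq_power2)

lemma sum_square: "(\<Sum>i\<in>I. (f i :: 'a))^2 = (\<Sum>i\<in>I. (f i)^2)"
  by (induction I rule: infinite_finite_induct) (auto simp: square_add)

lemma of_nat_char2: "(of_nat n :: 'a) = (if even n then 0 else 1)"
  by (induction n) auto

lemma coeff_frob [simp]: "coeff (frob_poly p) n = (coeff p n :: 'a)^2"
  by (simp add: frob_poly_def coeff_map_poly)

lemma frob_poly_0 [simp]: "frob_poly (0::'a poly) = 0"
  by (rule poly_eqI) simp

lemma frob_poly_1 [simp]: "frob_poly (1::'a poly) = 1"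
  by (rule poly_eqI) simp

lemma frob_poly_add: "frob_poly ((p::'a poly) + q) = frob_poly p + frob_poly q"
  by (rule poly_eqI) (simp add: square_add)

lemma frob_poly_mult: "frob_poly ((p::'a poly) * q) = frob_poly p * frob_poly q"
  by (rule poly_eqI) (simp add: coeff_mult sum_square power_mult_distrib)

lemma frob_poly_power: "frob_poly ((p::'a poly) ^ n) = frob_poly p ^ n"
  by (induction n) (auto simp: frob_poly_mult)

lemma frob_poly_smult: "frob_poly (smult (c::'a) p) = smult (c^2) (frob_poly p)"
  by (rule poly_eqI) (simp add: power_mult_distrib)

lemma frob_poly_pCons: "frob_poly (pCons (c::'a) p) = pCons (c^2) (frob_poly p)"
  by (rule poly_eqI) (simp add: coeff_pCons split: nat.splits)

lemma frob_poly_inj: "frob_poly (p::'a poly) = frob_poly q \<Longrightarrow> p = q"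
  by (metis coeff_frob poly_eqI square_inj)

lemma frob_poly_eq_0_iff [simp]: "frob_poly (p::'a poly) = 0 \<longleftrightarrow> p = 0"
  using frob_poly_inj by fastforce

lemma degree_frob [simp]: "degree (frob_poly (p::'a poly)) = degree p"
  by (simp add: frob_poly_def degree_map_poly)

lemma pderiv_frob: "pderiv (frob_poly (p::'a poly)) = frob_poly (pderiv p)"
  by (rule poly_eqI) (auto simp: coeff_pderiv power_mult_distrib of_nat_char2 simp del: of_nat_Suc)

lemma coeff_pderiv_char2: "coeff (pderiv (p::'a poly)) n = (if even n then coeff p (Suc n) else 0)"
  by (simp add: coeff_pderiv of_nat_char2 del: of_nat_Suc)

lemma pderiv_square [simp]: "pderiv ((p::'a poly)^2) = 0"
  by (simp add: power2_eq_square pderiv_mult algebra_simps)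

lemma pderiv_pderiv [simp]: "pderiv (pderiv (p::'a poly)) = 0"
  by (rule poly_eqI) (simp add: coeff_pderiv_char2)

lemma coeff_square: "coeff ((p::'a poly)^2) n = (if even n then (coeff p (n div 2))^2 else 0)"
proof (induction p arbitrary: n)
  case 0
  then show ?case by simp
next
  case (pCons a p)
  have eq: "(pCons a p)^2 = [:a^2:] + pCons 0 (pCons 0 (p^2))"
  proof -
    have "pCons a p = [:a:] + pCons 0 p" by simp
    then have "(pCons a p)^2 = [:a:]^2 + (pCons 0 p)^2" by (simp only: square_add_poly)
    then show ?thesis by (simp add: power2_eq_square)
  qed
  show ?case
  proof (cases n)
    case 0
    then show ?thesis by (simp add: eq)
  next
    case (Suc m)
    show ?thesis
    proof (cases m)
      case 0
      then show ?thesis using Suc by (simp add: eq)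
    next
      case (Suc k)
      then show ?thesis using \<open>n = Suc m\<close> pCons.IH[of k] by (simp add: eq)
    qed
  qed
qed

text \<open>Zero derivative leaves only even exponents, so the polynomial is r(x^2), and squaring
  its coefficients gives the square of a polynomial. The twist appears because the coefficients of
  \<open>p\<close> need not be squares in the field.\<close>

lemma frob_eq_square:
  assumes "pderiv (p::'a poly) = 0"
  obtains s where "frob_poly p = s^2"
proof -
  define s where "s = Poly (map (\<lambda>i. coeff p (2 * i)) [0..<Suc (degree p)])"
  have s: "coeff s i = coeff p (2 * i)" for i
    by (auto simp: s_def nth_default_def coeff_eq_0 simp del: upt_Suc)
  have odd: "coeff p n = 0" if "odd n" for n
  proof -
    obtain m where m: "n = Suc m" "even m" using \<open>odd n\<close> by (cases n) auto
    show ?thesis using assms coeff_pderiv_char2[of p m] m by simp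
  qed
  have "frob_poly p = s^2"
    by (rule poly_eqI) (auto simp: coeff_square s odd elim!: evenE)
  then show ?thesis by (rule that)
qed

lemma coeff_frob_fixed:
  assumes "frob_poly (g::'a poly) = g"
  shows "coeff g n = 0 \<or> coeff g n = 1"
proof -
  have "(coeff g n)^2 = coeff g n" using coeff_frob[of g n] assms by simp
  then show ?thesis by (simp add: power2_eq_square)
qed

lemma frob_fixed_eq_square:
  assumes "frob_poly (g::'a poly) = g" "pderiv g = 0"
  obtains a where "g = a^2" "frob_poly a = a"
proof -
  obtain a where a: "g = a^2" using frob_eq_square[OF assms(2)] assms(1) by metis
  have "(frob_poly a)^2 = a^2" using a assms(1) by (metis frob_poly_power)
  then have "frob_poly a = a" by (rule square_inj_poly)
  then show ?thesis using a that by blast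
qed

end

text \<open>A nonzero element \<open>d\<close> of least degree in the ideal generated by
  \<open>u\<close> and \<open>w\<close> divides all its elements, by division with remainder.
  Cancelling \<open>d\<close> from its own representation gives the identity for the
  cofactors.\<close>

lemma poly_bezout:
  fixes u w :: "'a::field poly"
  assumes "u \<noteq> 0"
  obtains d a b u' w' where "u = d * u'" "w = d * w'" "a * u' + b * w' = 1" "d \<noteq> 0"
proof -
  define I where "I = {a * u + b * w |a b. True} - {0}"
  have "u \<in> I" unfolding I_def using assms
    by (intro DiffI CollectI exI[of _ 1] exI[of _ 0]) auto
  then obtain d where d: "d \<in> I" "\<And>e. e \<in> I \<Longrightarrow> degree d \<le> degree e"
    using ex_has_least_nat[of "\<lambda>x. x \<in> I" u degree] by blast
  then obtain a b where ab: "d = a * u + b * w" "d \<noteq> 0" by (auto simp: I_def)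
  have dvd: "d dvd v" if v: "v = x * u + y * w" for v x y
  proof (rule ccontr)
    assume "\<not> d dvd v"
    then have nz: "v mod d \<noteq> 0" by (simp add: dvd_eq_mod_eq_0)
    have "v mod d = (x - v div d * a) * u + (y - v div d * b) * w"
      unfolding minus_div_mult_eq_mod[symmetric] by (simp add: v ab(1) algebra_simps)
    then have "v mod d \<in> I" using nz unfolding I_def by blast
    then have "degree d \<le> degree (v mod d)" by (rule d(2))
    moreover have "degree (v mod d) < degree d" 
      using degree_mod_less[of d v] ab(2) nz by simp
    ultimately show False by simp
  qed
  have "d dvd u" "d dvd w" using dvd[of u 1 0] dvd[of w 0 1] by auto
  then obtain u' w' where uw: "u = d * u'" "w = d * w'" by (auto elim!: dvdE)
  have "d * (a * u' + b * w') = d * 1" using ab(1) uw by (simp add: algebra_simps)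
  then have "a * u' + b * w' = 1" using ab(2) mult_left_cancel by blast
  then show ?thesis using that uw ab(2) by blast
qed

section \<open>A functional equation without rational solutions\<close>

context char2_field
begin

text \<open>This is the derivative of (x + s) y.\<close>

definition euler_poly :: "'a \<Rightarrow> 'a poly \<Rightarrow> 'a poly" where
  "euler_poly s y = y + [:s, 1:] * pderiv y"

lemma coeff_euler_poly:
  "coeff (euler_poly s y) i = (if even i then coeff y i + s * coeff y (Suc i) else 0)"
proof (cases i)
  case 0
  then show ?thesis by (simp add: euler_poly_def coeff_pderiv_char2)
next
  case (Suc k)
  then show ?thesis by (simp add: euler_poly_def coeff_pderiv_char2)
qed

lemma degree_euler_poly: "degree (euler_poly s y) \<le> degree y"
  by (rule degree_le) (auto simp: coeff_euler_poly coeff_eq_0)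

lemma F2_independent:
  assumes "(x::'a) = 0 \<or> x = 1" "y = 0 \<or> y = 1" "t \<noteq> 0" "t \<noteq> 1" "x + t * y = 0"
  shows "x = 0 \<and> y = 0"
  using assms by (auto simp: add_eq_0_iff_eq)

text \<open>The even coefficients are a_i + t a_{i+1} with both a's in F_2; as \<open>t\<close> is
  not in F_2, 1 and \<open>t\<close> are independent over F_2 and both a's can be read off.\<close>

lemma euler_poly_eq_0:
  fixes a :: "'a poly"
  assumes "frob_poly a = a" "t \<noteq> 0" "t \<noteq> 1" "even i" "coeff (euler_poly t a) i = 0"
  shows "coeff a i = 0 \<and> coeff a (Suc i) = 0"
  using assms coeff_frob_fixed[OF assms(1)] F2_independent[of "coeff a i" "coeff a (Suc i)" t]
  by (simp add: coeff_euler_poly)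

text \<open>Since \<open>euler_poly\<close> never raises the degree, 2 deg y + deg (euler_poly t a)
  \<le> deg y, so both degrees are 0. Then every coefficient of \<open>a\<close> from index 2 on
  vanishes.\<close>

lemma euler_degree_bound:
  fixes a y v :: "'a poly"
  assumes a: "frob_poly a = a" "a \<noteq> 0" and t: "t \<noteq> 0" "t \<noteq> 1"
    and eq: "euler_poly s y = smult \<omega> (v * euler_poly t a)" and \<omega>: "\<omega> \<noteq> 0"
    and deg: "degree v = 2 * degree y" and v: "v \<noteq> 0"
  shows "degree y = 0" "a = [:coeff a 0, coeff a 1:]"
proof -
  have nz: "euler_poly t a \<noteq> 0"
  proof
    assume z: "euler_poly t a = 0"
    have "coeff a i = 0" for i
    proof (cases "even i")
      case True
      then show ?thesis using euler_poly_eq_0[OF a(1) t, of i] z by simp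
    next
      case False
      then obtain k where "i = Suc k" "even k" by (cases i) auto
      then show ?thesis using euler_poly_eq_0[OF a(1) t, of k] z by simp
    qed
    then show False using a(2) by (metis poly_eqI coeff_0)
  qed
  have "degree (smult \<omega> (v * euler_poly t a)) = degree v + degree (euler_poly t a)"
    using nz v \<omega> by (simp add: degree_mult_eq)
  then have "2 * degree y + degree (euler_poly t a) \<le> degree y"
    using degree_euler_poly[of s y] eq deg by simp
  then have dy: "degree y = 0" and d0: "degree (euler_poly t a) = 0" by auto
  show "degree y = 0" by (rule dy)
  have z: "coeff a i = 0" if "i \<ge> 2" for i
  proof (cases "even i")
    case True
    then show ?thesis using euler_poly_eq_0[OF a(1) t, of i] d0 that by (simp add: coeff_eq_0)
  next
    case False
    then obtain k where "i = Suc k" "even k" by (cases i) auto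
    moreover from this have "k > 0" using that by (cases k) auto
    ultimately show ?thesis using euler_poly_eq_0[OF a(1) t, of k] d0 by (simp add: coeff_eq_0)
  qed
  show "a = [:coeff a 0, coeff a 1:]"
    by (rule poly_eqI) (auto simp: coeff_pCons z split: nat.splits)
qed

section \<open>Reduction of the functional equation to two polynomial systems\<close>

lemma degree_square: "degree ((p::'a poly)^2) = 2 * degree p"
  by (cases "p = 0") (simp_all add: power2_eq_square degree_mult_eq)

lemma degree_pderiv_le: "degree (pderiv (p::'a poly)) \<le> degree p - 1"
  by (rule degree_le) (auto simp: coeff_pderiv_char2 coeff_eq_0)

text \<open>The solution is u / w in lowest terms with \<open>u\<close> monic; the linear factor x +
  t^2 stays with the twist of \<open>u\<close>, so deg w = 2 deg u is even.\<close>

lemma no_solution_even: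
  fixes g u w :: "'a poly"
  assumes g: "frob_poly g = g" and t: "t \<noteq> 0" "t \<noteq> 1" and u: "lead_coeff u = 1" and \<omega>: "\<omega> \<noteq> 0"
    and eq1: "[:t^2, 1:] * frob_poly u = smult (\<omega>^2) (g * u^2 + w^2)"
    and eq2: "frob_poly w = smult (\<omega>^2) (u^2)"
  shows False
proof -
  have u0: "u \<noteq> 0" using u by auto
  have pt: "[:t^2, 1:] = frob_poly [:t, 1:]" by (simp add: frob_poly_pCons)
  \<comment> \<open>Derivative of \<open>eq1\<close>: the left side is the twist of (x + t) u, and
    w^2 disappears on the right.\<close>
  have der: "frob_poly (pderiv ([:t, 1:] * u)) = smult (\<omega>^2) (pderiv g * u^2)"
  proof -
    have "pderiv (frob_poly ([:t, 1:] * u)) = pderiv (smult (\<omega>^2) (g * u^2 + w^2))"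
      using eq1 unfolding pt by (simp only: frob_poly_mult)
    then show ?thesis
      by (simp only: pderiv_frob pderiv_smult pderiv_add pderiv_mult pderiv_square)
         (simp add: algebra_simps)
  qed
  have w': "pderiv w = 0"
  proof -
    have "frob_poly (pderiv w) = 0" 
      unfolding pderiv_frob[symmetric] eq2 by (simp only: pderiv_smult pderiv_square smult_0_right)
    then show ?thesis by simp
  qed
  have degw: "degree w = 2 * degree u"
    using arg_cong[OF eq2, of degree] \<omega> by (simp add: degree_square)
  show False
  proof (cases "pderiv g = 0")
    \<comment> \<open>Here deg g' + 2 deg u \<le> deg u, so u = 1; comparing the two coefficients of
      the remaining linear equation puts t^2 in F_2.\<close>
    case False
    then have "degree (smult (\<omega>^2) (pderiv g * u^2)) = degree (pderiv g) + 2 * degree u"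
      using u0 \<omega> by (simp add: degree_mult_eq degree_square)
    moreover have "degree (pderiv ([:t, 1:] * u)) \<le> degree u"
      using degree_pderiv_le[of "[:t, 1:] * u"] u0 by (simp add: degree_mult_eq del: mult_pCons_left)
    ultimately have d: "degree u = 0" using arg_cong[OF der, of degree] by simp
    then have u1: "u = 1" using u by (auto elim!: degree_eq_zeroE)
    obtain x where x: "w = [:x:]" using degw d by (auto elim!: degree_eq_zeroE)
    have "x^2 = \<omega>^2" using eq2 u1 x by (simp add: frob_poly_pCons)
    then have x\<omega>: "x = \<omega>" by (rule square_inj)
    have e: "[:t^2, 1:] = smult (\<omega>^2) (g + [:\<omega>^2:])"
      using eq1 u1 x x\<omega> by (simp add: power2_eq_square)
    have "coeff g 0 = 0 \<or> coeff g 0 = 1" "coeff g 1 = 0 \<or> coeff g 1 = 1"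
      using coeff_frob_fixed[OF g] by auto
    moreover have "1 = \<omega>^2 * coeff g 1" using arg_cong[OF e, of "\<lambda>p. coeff p 1"] by simp
    moreover have "t^2 = \<omega>^2 * (coeff g 0 + \<omega>^2)" using arg_cong[OF e, of "\<lambda>p. coeff p 0"] by simp
    ultimately have "t^2 = 0 \<or> t^2 = 1" by auto
    then show False using t square_inj[of t 1] by auto
  next
    case g': True
    obtain a where a: "g = a^2" "frob_poly a = a" using frob_fixed_eq_square[OF g g'] .
    define v where "v = pderiv u"
    have uv: "u = [:t, 1:] * v"
    proof -
      have "pderiv ([:t, 1:] * u) = 0" using der g' by simp
      then have "u + [:t, 1:] * v = 0" 
        unfolding v_def by (simp only: pderiv_mult) (simp add: pderiv_pCons algebra_simps)
      then show ?thesis by (simp add: poly_add_eq_0_iff_eq del: mult_pCons_left)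
    qed
    have v': "pderiv v = 0" by (simp add: v_def)
    then obtain y where y: "frob_poly v = y^2" using frob_eq_square by blast
    have v1: "lead_coeff v = 1" using u unfolding uv by (simp add: lead_coeff_mult del: mult_pCons_left)
    have degv: "degree v = 2 * degree y" using arg_cong[OF y, of degree] by (simp add: degree_square)
    have degu: "degree u = Suc (degree v)"
      using v1 unfolding uv by (subst degree_mult_eq) auto
    \<comment> \<open>Multiplied by x + t^2, \<open>eq1\<close> becomes an equation between squares,
      because its left side is then (x + t^2)^2 times the twist of \<open>v\<close>, which is
      y^2.\<close>
    have key: "[:t^2, 1:] * y = smult \<omega> (a * u + w)"
    proof (rule square_inj_poly)
      have "([:t^2, 1:] * y)^2 = [:t^2, 1:] * ([:t^2, 1:] * frob_poly v)"
        unfolding y by (simp only: power2_eq_square ac_simps)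
      also have "[:t^2, 1:] * frob_poly v = frob_poly u"
        unfolding uv pt frob_poly_mult ..
      also have "[:t^2, 1:] * frob_poly u = (smult \<omega> (a * u + w))^2"
        unfolding eq1 a(1) by (simp add: smult_power square_add_poly power_mult_distrib)
      finally show "([:t^2, 1:] * y)^2 = (smult \<omega> (a * u + w))^2" .
    qed
    \<comment> \<open>With a = 0 the degrees would satisfy deg y + 1 = deg w = 2 deg u = 4 deg y +
      2.\<close>
    have a0: "a \<noteq> 0"
    proof
      assume "a = 0"
      then have "degree ([:t^2, 1:] * y) = degree w" unfolding key using \<omega> by simp
      moreover have "y \<noteq> 0" using y v1 by auto
      ultimately have "Suc (degree y) = degree w" by (subst (asm) degree_mult_eq) auto
      then show False using degw degu degv by simp
    qed
    \<comment> \<open>Derivative of \<open>key\<close>: since v' = w' = 0, only the factor (x + t) a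
      of a u = v (x + t) a is differentiated on the right.\<close>
    have eul: "euler_poly (t^2) y = smult \<omega> (v * euler_poly t a)"
    proof -
      have "pderiv ([:t^2, 1:] * y) = euler_poly (t^2) y"
        unfolding euler_poly_def pderiv_mult by (simp add: pderiv_pCons algebra_simps)
      moreover have "pderiv (smult \<omega> (a * u + w)) = smult \<omega> (v * euler_poly t a)"
      proof -
        have "pderiv (a * u) = v * euler_poly t a"
          unfolding euler_poly_def pderiv_mult v_def[symmetric] by (simp only: uv ring_distribs ac_simps)
        then show ?thesis by (simp add: pderiv_smult pderiv_add w')
      qed
      ultimately show ?thesis using key by metis
    qed
    have v0: "v \<noteq> 0" using v1 by auto
    note bd = euler_degree_bound[OF a(2) a0 t eul \<omega> degv v0]
    have "v = 1" using v1 degv bd(1) by (auto elim!: degree_eq_zeroE)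
    have "y = 1"
    proof (rule square_inj_poly)
      show "y^2 = 1^2" using y \<open>v = 1\<close> by simp
    qed
    have "u = [:t, 1:]" using uv \<open>v = 1\<close> by simp
    \<comment> \<open>Coefficient 2 of this identity forces \<omega> = a_1 = 1, and coefficient 1
      then gives t = a_0 + 1, an element of F_2.\<close>
    have e: "[:t^2, 1:] = smult \<omega> (a * [:t, 1:] + w)" using key \<open>y = 1\<close> \<open>u = [:t, 1:]\<close> by simp
    have w2: "coeff w 2 = \<omega>"
    proof (rule square_inj)
      show "(coeff w 2)^2 = \<omega>^2"
        using arg_cong[OF eq2, of "\<lambda>p. coeff p 2"] \<open>u = [:t, 1:]\<close> by (simp add: coeff_square)
    qed
    have w1: "coeff w 1 = 0"
      using arg_cong[OF w', of "\<lambda>p. coeff p 0"] by (simp add: coeff_pderiv_char2)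
    have a1: "coeff a 0 = 0 \<or> coeff a 0 = 1" "coeff a 1 = 0 \<or> coeff a 1 = 1"
      using coeff_frob_fixed[OF a(2)] by auto
    have a2: "coeff (a * [:t, 1:]) 2 = coeff a 1" "coeff (a * [:t, 1:]) 1 = coeff a 0 + t * coeff a 1"
      by (subst bd(2), simp add: numeral_2_eq_2)+
    have a22: "coeff a 2 = 0"
      by (subst bd(2)) (simp add: numeral_2_eq_2)
    have "0 = \<omega> * (coeff a 1 + \<omega>)" using arg_cong[OF e, of "\<lambda>p. coeff p 2"] a2 a22 w2
      by (simp add: numeral_2_eq_2)
    then have "coeff a 1 = \<omega>" using \<omega> by (simp add: add_eq_0_iff_eq)
    then have "\<omega> = 1" using a1 \<omega> by auto
    have "1 = \<omega> * (coeff a 0 + t * coeff a 1 + 0)" using arg_cong[OF e, of "\<lambda>p. coeff p 1"] a2 w1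
      by (simp add: add.commute)
    then have "coeff a 0 + t = 1" using \<open>\<omega> = 1\<close> \<open>coeff a 1 = \<omega>\<close> by simp
    then show False using a1 t by (metis add.left_neutral add_eq_0_iff_eq add_cancel_right_right)
  qed
qed

text \<open>The complementary case: x + t^2 has moved to the equation for \<open>w\<close>, whose
  degree 2 deg u + 1 is odd.\<close>

lemma no_solution_odd:
  fixes g u w :: "'a poly"
  assumes g: "frob_poly g = g" and t: "t \<noteq> 0" "t \<noteq> 1" and u: "lead_coeff u = 1" and \<omega>: "\<omega> \<noteq> 0"
    and eq1: "frob_poly u = smult (\<omega>^2) (g * u^2 + w^2)"
    and eq2: "frob_poly w = smult (\<omega>^2) ([:t^2, 1:] * u^2)"
  shows False
proof -
  have u0: "u \<noteq> 0" using u by auto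
  have pt: "[:t^2, 1:] = frob_poly [:t, 1:]" by (simp add: frob_poly_pCons)
  have der: "frob_poly (pderiv u) = smult (\<omega>^2) (pderiv g * u^2)"
  proof -
    have "pderiv (frob_poly u) = pderiv (smult (\<omega>^2) (g * u^2 + w^2))"
      using eq1 by simp
    then show ?thesis
      by (simp only: pderiv_frob pderiv_smult pderiv_add pderiv_mult pderiv_square)
         (simp add: algebra_simps)
  qed
  \<comment> \<open>Differentiating \<open>eq2\<close> deletes the factor x + t^2; comparison with
    \<open>eq2\<close> itself shows that (x + t) w has derivative zero.\<close>
  have w': "w = [:t, 1:] * pderiv w"
  proof (rule frob_poly_inj)
    have "frob_poly (pderiv w) = smult (\<omega>^2) (u^2)" 
      unfolding pderiv_frob[symmetric] eq2 pderiv_smult pderiv_mult pderiv_square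
      by (simp add: pderiv_pCons)
    then show "frob_poly w = frob_poly ([:t, 1:] * pderiv w)"
      unfolding frob_poly_mult pt[symmetric] eq2 by (simp only: mult_smult_right)
  qed
  have degw: "degree w = Suc (2 * degree u)"
  proof -
    have "degree (smult (\<omega>^2) ([:t^2, 1:] * u^2)) = Suc (2 * degree u)"
      using u0 \<omega> degree_mult_eq[of "[:t^2,1:]" "u^2"]
      by (simp add: degree_square del: mult_pCons_left)
    then show ?thesis using arg_cong[OF eq2, of degree] by simp
  qed
  have g': "pderiv g = 0"
  proof (rule ccontr)
    assume nz: "pderiv g \<noteq> 0"
    then have "degree (smult (\<omega>^2) (pderiv g * u^2)) = degree (pderiv g) + 2 * degree u"
      using u0 \<omega> by (simp add: degree_mult_eq degree_square)
    then have "2 * degree u \<le> degree u - 1"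
      using arg_cong[OF der, of degree] degree_pderiv_le[of u] by simp
    then have "degree u = 0" by simp
    then have "pderiv u = 0" by (auto elim!: degree_eq_zeroE)
    then show False using der nz u0 \<omega> by simp
  qed
  obtain a where a: "g = a^2" "frob_poly a = a" using frob_fixed_eq_square[OF g g'] .
  have u': "pderiv u = 0" using der g' by simp
  then obtain x where x: "frob_poly u = x^2" using frob_eq_square by blast
  have degu: "degree u = 2 * degree x" using arg_cong[OF x, of degree] by (simp add: degree_square)
  have key: "x = smult \<omega> (a * u + w)"
  proof (rule square_inj_poly)
    show "x^2 = (smult \<omega> (a * u + w))^2"
      unfolding x[symmetric] eq1 a(1) by (simp add: smult_power square_add_poly power_mult_distrib)
  qed
  have a0: "a \<noteq> 0"
  proof
    assume "a = 0"
    then have "degree x = degree w" unfolding key using \<omega> by simp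
    then show False using degw degu by simp
  qed
  \<comment> \<open>Apply \<open>euler_poly t\<close> to \<open>key\<close>: the contribution of
    \<open>w\<close> is w + (x + t) w' = w + w = 0.\<close>
  have eul: "euler_poly t x = smult \<omega> (u * euler_poly t a)"
  proof -
    have "pderiv x = smult \<omega> (u * pderiv a + pderiv w)"
      unfolding key by (simp add: pderiv_smult pderiv_add pderiv_mult u')
    then have "euler_poly t x = smult \<omega> (a * u + w) + smult \<omega> ([:t, 1:] * (u * pderiv a) + [:t, 1:] * pderiv w)"
      unfolding euler_poly_def by (subst key) (simp only: mult_smult_right distrib_left)
    also have "[:t, 1:] * pderiv w = w" using w' by simp
    also have "smult \<omega> (a * u + w) + smult \<omega> ([:t, 1:] * (u * pderiv a) + w)
      = smult \<omega> (u * (a + [:t, 1:] * pderiv a) + (w + w))"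
      by (simp only: smult_add_right ring_distribs ac_simps)
    finally show ?thesis unfolding euler_poly_def by simp
  qed
  note bd = euler_degree_bound[OF a(2) a0 t eul \<omega> degu u0]
  have "u = 1" using u degu bd(1) by (auto elim!: degree_eq_zeroE)
  have "x = 1"
  proof (rule square_inj_poly)
    show "x^2 = 1^2" using x \<open>u = 1\<close> by simp
  qed
  have e: "1 = smult \<omega> (a + w)" using key \<open>x = 1\<close> \<open>u = 1\<close> by simp
  have w1: "coeff w 1 = \<omega>"
    by (rule square_inj) (use arg_cong[OF eq2, of "\<lambda>p. coeff p 1"] \<open>u = 1\<close> in simp)
  have w0: "coeff w 0 = \<omega> * t"
    by (rule square_inj)
       (use arg_cong[OF eq2, of "\<lambda>p. coeff p 0"] \<open>u = 1\<close> in \<open>simp add: power_mult_distrib\<close>)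
  have a1: "coeff a 0 = 0 \<or> coeff a 0 = 1" "coeff a 1 = 0 \<or> coeff a 1 = 1"
    using coeff_frob_fixed[OF a(2)] by auto
  have "0 = \<omega> * (coeff a 1 + \<omega>)" using arg_cong[OF e, of "\<lambda>p. coeff p 1"] w1 by simp
  then have "coeff a 1 = \<omega>" using \<omega> by (simp add: add_eq_0_iff_eq)
  then have "\<omega> = 1" using a1 \<omega> by auto
  have "1 = \<omega> * (coeff a 0 + \<omega> * t)" using arg_cong[OF e, of "\<lambda>p. coeff p 0"] w0 by simp
  then have "coeff a 0 + t = 1" using \<open>\<omega> = 1\<close> by simp
  then show False using a1 t by (metis add.left_neutral add_eq_0_iff_eq add_cancel_right_right)
qed

text \<open>For q = u / w this is (x + t^2) q' q^2 = g q^2 + 1 with denominators cleared. It is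
  homogeneous, so common factors and scalars can be removed. Coprimality then distributes the linear
  polynomial x + t^2 over two factors, one of which is constant; this gives the two cases.\<close>

theorem no_solution:
  fixes g u w :: "'a poly"
  assumes g: "frob_poly g = g" and t: "t \<noteq> 0" "t \<noteq> 1" and u0: "u \<noteq> 0"
    and eq: "[:t^2, 1:] * frob_poly u * u^2 = frob_poly w * (g * u^2 + w^2)"
  shows False
proof -
  obtain d a b u' w' where uw: "u = d * u'" "w = d * w'" and bez: "a * u' + b * w' = 1" and d0: "d \<noteq> 0"
    using poly_bezout[OF u0] .
  define l where "l = inverse (lead_coeff u')"
  have u'0: "u' \<noteq> 0" using uw u0 by auto
  then have l0: "l \<noteq> 0" by (simp add: l_def)
  define v z where "v = smult l u'" and "z = smult l w'"
  have v1: "lead_coeff v = 1" using u'0 by (simp add: v_def l_def)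
  have "(frob_poly d * d^2) * ([:t^2, 1:] * frob_poly u' * u'^2)
      = (frob_poly d * d^2) * (frob_poly w' * (g * u'^2 + w'^2))"
    using eq unfolding uw frob_poly_mult power_mult_distrib by (simp only: distrib_left ac_simps)
  moreover have "frob_poly d * d^2 \<noteq> 0" using d0 by simp
  ultimately have eq': "[:t^2, 1:] * frob_poly u' * u'^2 = frob_poly w' * (g * u'^2 + w'^2)"
    using mult_left_cancel by blast
  have eqv: "[:t^2, 1:] * frob_poly v * v^2 = frob_poly z * (g * v^2 + z^2)"
  proof -
    have "[:t^2, 1:] * frob_poly v * v^2 = smult (l^2 * l^2) ([:t^2, 1:] * frob_poly u' * u'^2)"
      unfolding v_def frob_poly_smult smult_power by (simp only: mult_smult_left mult_smult_right smult_smult ac_simps)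
    also have "\<dots> = frob_poly z * (g * v^2 + z^2)"
      unfolding eq' v_def z_def frob_poly_smult smult_power
      by (simp only: mult_smult_left mult_smult_right smult_smult smult_add_right[symmetric] ac_simps)
    finally show ?thesis .
  qed
  define a' b' where "a' = smult (inverse l) a" and "b' = smult (inverse l) b"
  have bez': "a' * v + b' * z = 1"
    using bez l0 by (simp add: a'_def b'_def v_def z_def)
  have bez2: "a'^2 * v^2 + b'^2 * z^2 = 1"
    using arg_cong[OF bez', of "\<lambda>p. p^2"] by (simp add: square_add_poly power_mult_distrib)
  have bezf: "frob_poly a' * frob_poly v + frob_poly b' * frob_poly z = 1"
    using arg_cong[OF bez', of frob_poly] by (simp add: frob_poly_add frob_poly_mult)
  have v0: "v \<noteq> 0" using v1 by auto
  \<comment> \<open>By \<open>eqv\<close>, v^2 divides the twist of \<open>z\<close> times z^2, and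
    by \<open>bez2\<close> it is coprime to z^2.\<close>
  have "v^2 dvd frob_poly z"
  proof -
    have "frob_poly z = frob_poly z * (a'^2 * v^2 + b'^2 * z^2) + (b'^2 * frob_poly z * g * v^2 + b'^2 * frob_poly z * g * v^2)"
      by (simp add: bez2)
    also have "\<dots> = v^2 * (frob_poly z * a'^2 + b'^2 * frob_poly z * g) + b'^2 * (frob_poly z * (g * v^2 + z^2))"
      by (simp only: ring_distribs ac_simps)
    also have "\<dots> = v^2 * (frob_poly z * a'^2 + b'^2 * frob_poly z * g + b'^2 * ([:t^2, 1:] * frob_poly v))"
      unfolding eqv[symmetric] by (simp only: ring_distribs ac_simps)
    finally show ?thesis by (rule dvdI)
  qed
  then obtain e where e: "frob_poly z = v^2 * e" ..
  have "v^2 * ([:t^2, 1:] * frob_poly v) = v^2 * (e * (g * v^2 + z^2))"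
    using eqv unfolding e by (simp only: ac_simps)
  moreover have "v^2 \<noteq> 0" using v0 by simp
  ultimately have eqe: "[:t^2, 1:] * frob_poly v = e * (g * v^2 + z^2)"
    using mult_left_cancel by blast
  \<comment> \<open>The factor \<open>e\<close> divides the twist of \<open>z\<close> and, by
    \<open>eqe\<close>, x + t^2 times the twist of \<open>v\<close>; these twists are coprime, so
    \<open>e\<close> divides x + t^2.\<close>
  have "[:t^2, 1:] = [:t^2, 1:] * (frob_poly a' * frob_poly v + frob_poly b' * frob_poly z)"
    by (simp add: bezf)
  also have "\<dots> = frob_poly a' * ([:t^2, 1:] * frob_poly v) + [:t^2, 1:] * frob_poly b' * (v^2 * e)"
    unfolding e by (simp only: ring_distribs ac_simps)
  also have "\<dots> = e * (frob_poly a' * (g * v^2 + z^2) + [:t^2, 1:] * frob_poly b' * v^2)"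
    unfolding eqe by (simp only: ring_distribs ac_simps)
  finally obtain f where f: "[:t^2, 1:] = e * f" by blast
  have e0: "e \<noteq> 0" and f0: "f \<noteq> 0" using f by auto
  have dsum: "degree e + degree f = 1"
    using arg_cong[OF f, of degree] e0 f0 by (simp add: degree_mult_eq)
  define \<omega> where "\<omega> = lead_coeff z"
  have z0: "z \<noteq> 0"
  proof
    assume "z = 0"
    then have "v^2 * e = 0" using e by simp
    then show False using v0 e0 by simp
  qed
  then have \<omega>0: "\<omega> \<noteq> 0" by (simp add: \<omega>_def)
  have lce: "lead_coeff e = \<omega>^2"
  proof -
    have "lead_coeff (frob_poly z) = \<omega>^2" by (simp add: \<omega>_def)
    then show ?thesis unfolding e lead_coeff_mult by (simp only: lead_coeff_power v1 power_one mult_1)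
  qed
  show False
  proof (cases "degree e = 0")
    case True
    then have ee: "e = [:\<omega>^2:]" using lce by (auto elim!: degree_eq_zeroE)
    have "[:t^2, 1:] * frob_poly v = smult (\<omega>^2) (g * v^2 + z^2)"
      unfolding eqe ee by simp
    moreover have "frob_poly z = smult (\<omega>^2) (v^2)"
      unfolding e ee by simp
    ultimately show False by (rule no_solution_even[OF g t v1 \<omega>0])
  next
    case False
    then have "degree f = 0" using dsum by simp
    then obtain c where c: "f = [:c:]" by (auto elim!: degree_eq_zeroE)
    have c0: "c \<noteq> 0" using f0 c by simp
    have "lead_coeff e * c = 1" using arg_cong[OF f, of lead_coeff] unfolding c lead_coeff_mult by simp
    then have ee: "e = smult (\<omega>^2) [:t^2, 1:]"
      unfolding f c using lce by (simp add: mult.commute)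
    have "[:t^2, 1:] * frob_poly v = [:t^2, 1:] * smult (\<omega>^2) (g * v^2 + z^2)"
      unfolding eqe ee by (simp only: mult_smult_left mult_smult_right)
    moreover have "[:t^2, 1:] \<noteq> 0" by simp
    ultimately have "frob_poly v = smult (\<omega>^2) (g * v^2 + z^2)"
      using mult_left_cancel by blast
    moreover have "frob_poly z = smult (\<omega>^2) ([:t^2, 1:] * v^2)"
      unfolding e ee by (simp only: mult_smult_left mult_smult_right mult.commute)
    ultimately show False using no_solution_odd[OF g t v1 \<omega>0] by blast
  qed
qed

end

section \<open>Extension of automorphisms to a separable closure\<close>

lemma coprime_poly_bezout:
  fixes f h :: "'a::field poly"
  assumes "coprime f h" "f \<noteq> 0"
  obtains a b where "a * f + b * h = 1"
proof -
  obtain d a b f' h' where d: "f = d * f'" "h = d * h'" "a * f' + b * h' = 1" "d \<noteq> 0"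
    using poly_bezout[OF assms(2), where w = h] .
  have "is_unit d" using assms(1) d(1,2) by (auto intro: coprime_common_divisor)
  then obtain e where e: "1 = d * e" by blast
  have "(e * a) * f + (e * b) * h = (d * e) * (a * f' + b * h')"
    by (simp add: d(1,2) algebra_simps)
  then show ?thesis using that d(3) e by simp
qed

lemma separable_dvd:
  fixes f m :: "'a::field poly"
  assumes "coprime f (pderiv f)" "m dvd f"
  shows "coprime m (pderiv m)"
proof (rule coprimeI)
  fix d assume d: "d dvd m" "d dvd pderiv m"
  obtain q where q: "f = m * q" using assms(2) ..
  have "d dvd f" "d dvd pderiv f" using d by (auto simp: q pderiv_mult)
  then show "is_unit d" using assms(1) by (rule coprime_common_divisor[rotated])
qed

locale field_hom =
  fixes iota :: "'b::field \<Rightarrow> 'k::field"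
  assumes hom: "is_field_hom iota"
begin

lemma hom_1 [simp]: "iota 1 = 1" and hom_add: "iota (x + y) = iota x + iota y"
  and hom_mult: "iota (x * y) = iota x * iota y"
  using hom by (auto simp: is_field_hom_def)

lemma hom_0 [simp]: "iota 0 = 0"
  using hom_add[of 0 0] by (metis add_0 add_cancel_right_right)

lemma hom_minus: "iota (- x) = - iota x"
  using hom_add[of x "- x"] by (simp add: eq_neg_iff_add_eq_0 add.commute)

lemma hom_diff: "iota (x - y) = iota x - iota y"
  using hom_add[of x "- y"] by (simp add: hom_minus)

lemma hom_power: "iota (x ^ n) = iota x ^ n"
  by (induction n) (auto simp: hom_mult)

lemma hom_eq_0_iff [simp]: "iota x = 0 \<longleftrightarrow> x = 0"
proof
  assume "iota x = 0"
  show "x = 0"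
  proof (rule ccontr)
    assume "x \<noteq> 0"
    then have "iota x * iota (inverse x) = 1" by (simp flip: hom_mult)
    then show False using \<open>iota x = 0\<close> by simp
  qed
qed simp

lemma hom_eq_iff [simp]: "iota x = iota y \<longleftrightarrow> x = y"
  using hom_eq_0_iff[of "x - y"] by (simp add: hom_diff del: hom_eq_0_iff)

lemma hom_inverse: "iota (inverse x) = inverse (iota x)"
proof (cases "x = 0")
  case False
  then have "iota x * iota (inverse x) = 1" by (simp flip: hom_mult)
  then show ?thesis by (metis inverse_unique)
qed simp

lemma hom_divide: "iota (x / y) = iota x / iota y"
  by (simp add: divide_inverse hom_mult hom_inverse)

lemma hom_sum: "iota (sum f A) = (\<Sum>x\<in>A. iota (f x))"
  by (induction A rule: infinite_finite_induct) (auto simp: hom_add)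

lemma hom_of_nat: "iota (of_nat n) = of_nat n"
  by (induction n) (auto simp: hom_add)

abbreviation hom_poly :: "'b poly \<Rightarrow> 'k poly" where
  "hom_poly \<equiv> map_poly iota"

lemma coeff_hom_poly [simp]: "coeff (hom_poly p) n = iota (coeff p n)"
  by (simp add: coeff_map_poly)

lemma degree_hom_poly [simp]: "degree (hom_poly p) = degree p"
  by (simp add: degree_map_poly)

lemma hom_poly_eq_0_iff [simp]: "hom_poly p = 0 \<longleftrightarrow> p = 0"
  by (simp add: poly_eq_iff)

lemma hom_poly_add: "hom_poly (p + q) = hom_poly p + hom_poly q"
  by (rule poly_eqI) (simp add: hom_add)

lemma hom_poly_smult: "hom_poly (smult c p) = smult (iota c) (hom_poly p)"
  by (rule poly_eqI) (simp add: hom_mult)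

lemma hom_poly_mult: "hom_poly (p * q) = hom_poly p * hom_poly q"
  by (rule poly_eqI) (simp add: coeff_mult hom_sum hom_mult)

lemma hom_poly_pCons: "hom_poly (pCons c p) = pCons (iota c) (hom_poly p)"
  by (rule poly_eqI) (simp add: coeff_pCons split: nat.splits)

lemma hom_poly_pderiv: "hom_poly (pderiv p) = pderiv (hom_poly p)"
  by (rule poly_eqI) (simp add: coeff_pderiv hom_mult hom_of_nat del: of_nat_Suc)

lemma poly_hom_poly: "poly (hom_poly p) (iota x) = iota (poly p x)"
  by (induction p) (auto simp: hom_add hom_mult hom_poly_pCons)

text \<open>Coprimality survives the field extension because a Bezout identity is transported by the
  homomorphism.\<close>

lemma hom_poly_coprime_pderiv:
  assumes "coprime f (pderiv f)" "f \<noteq> 0"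
  shows "coprime (hom_poly f) (pderiv (hom_poly f))"
proof (rule coprimeI)
  fix d assume d: "d dvd hom_poly f" "d dvd pderiv (hom_poly f)"
  obtain a b where "a * f + b * pderiv f = 1" using coprime_poly_bezout[OF assms] .
  then have "hom_poly a * hom_poly f + hom_poly b * pderiv (hom_poly f) = 1"
    by (metis hom_poly_add hom_poly_mult hom_poly_pderiv map_poly_1' hom_1)
  moreover have "d dvd hom_poly a * hom_poly f + hom_poly b * pderiv (hom_poly f)"
    using d by (intro dvd_add dvd_mult) auto
  ultimately show "is_unit d" by simp
qed

end

locale sep_closure =
  fixes iota :: "F \<Rightarrow> 'k::field"
  assumes sep_closure: "separable_closure iota"
begin

sublocale field_hom iota
  using sep_closure by unfold_locales (simp add: separable_closure_def)

lemma separable_root: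
  fixes f :: "'k poly"
  assumes "degree f \<ge> 1" "coprime f (pderiv f)"
  obtains x where "poly f x = 0"
  using assms sep_closure unfolding separable_closure_def by blast

lemma separable_annihilator:
  obtains f :: "F poly" where "f \<noteq> 0" "coprime f (pderiv f)" "poly (hom_poly f) x = 0"
  using sep_closure unfolding separable_closure_def by blast

text \<open>A partial homomorphism over the base field is represented by its graph.\<close>

definition partial_hom :: "('k \<times> 'k) set \<Rightarrow> bool" where
  "partial_hom G \<longleftrightarrow> (\<forall>c. (iota c, iota c) \<in> G) \<and>
     (\<forall>x y x' y'. (x, y) \<in> G \<longrightarrow> (x', y') \<in> G \<longrightarrow> (x + x', y + y') \<in> G \<and> (x * x', y * y') \<in> G) \<and>
     (\<forall>x y y'. (x, y) \<in> G \<longrightarrow> (x, y') \<in> G \<longrightarrow> y = y')"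

definition rel_poly :: "('k \<times> 'k) set \<Rightarrow> 'k poly \<Rightarrow> 'k poly \<Rightarrow> bool" where
  "rel_poly G a b \<longleftrightarrow> (\<forall>i. (coeff a i, coeff b i) \<in> G)"

text \<open>Polynomial values suffice, without quotients: elements of K are algebraic over the base
  field, so inverses are polynomial values too.\<close>

definition adjoin :: "('k \<times> 'k) set \<Rightarrow> 'k \<Rightarrow> 'k \<Rightarrow> ('k \<times> 'k) set" where
  "adjoin G z z' = {(poly a z, poly b z') |a b. rel_poly G a b}"

context
  fixes G assumes G: "partial_hom G"
begin

lemma partial_hom_base: "(iota c, iota c) \<in> G"
  and partial_hom_add: "(x, y) \<in> G \<Longrightarrow> (x', y') \<in> G \<Longrightarrow> (x + x', y + y') \<in> G"
  and partial_hom_mult: "(x, y) \<in> G \<Longrightarrow> (x', y') \<in> G \<Longrightarrow> (x * x', y * y') \<in> G"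
  and partial_hom_unique: "(x, y) \<in> G \<Longrightarrow> (x, y') \<in> G \<Longrightarrow> y = y'"
  using G unfolding partial_hom_def by blast+

lemma partial_hom_0: "(0, 0) \<in> G" and partial_hom_1: "(1, 1) \<in> G"
  using partial_hom_base[of 0] partial_hom_base[of 1] by auto

lemma partial_hom_minus: "(x, y) \<in> G \<Longrightarrow> (- x, - y) \<in> G"
  using partial_hom_mult[OF partial_hom_base[of "- 1"], of x y] by (simp add: hom_minus)

lemma partial_hom_sum: "(\<And>i. i \<in> A \<Longrightarrow> (f i, h i) \<in> G) \<Longrightarrow> (sum f A, sum h A) \<in> G"
  by (induction A rule: infinite_finite_induct) (auto intro: partial_hom_0 partial_hom_add)

lemma rel_poly_add: "rel_poly G a b \<Longrightarrow> rel_poly G a' b' \<Longrightarrow> rel_poly G (a + a') (b + b')"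
  by (simp add: rel_poly_def partial_hom_add)

lemma rel_poly_minus: "rel_poly G a b \<Longrightarrow> rel_poly G (- a) (- b)"
  by (simp add: rel_poly_def partial_hom_minus)

lemma rel_poly_diff: "rel_poly G a b \<Longrightarrow> rel_poly G a' b' \<Longrightarrow> rel_poly G (a - a') (b - b')"
  using rel_poly_add[of a b "- a'" "- b'"] rel_poly_minus[of a' b'] by simp

lemma rel_poly_mult: "rel_poly G a b \<Longrightarrow> rel_poly G a' b' \<Longrightarrow> rel_poly G (a * a') (b * b')"
  by (auto simp: rel_poly_def coeff_mult intro!: partial_hom_sum partial_hom_mult)

lemma rel_poly_monom: "(x, y) \<in> G \<Longrightarrow> rel_poly G (monom x n) (monom y n)"
  by (simp add: rel_poly_def partial_hom_0)

lemma rel_poly_smult: "(x, y) \<in> G \<Longrightarrow> rel_poly G a b \<Longrightarrow> rel_poly G (smult x a) (smult y b)"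
  by (simp add: rel_poly_def partial_hom_mult)

lemma rel_poly_hom_poly: "rel_poly G (hom_poly f) (hom_poly f)"
  by (simp add: rel_poly_def partial_hom_base)

lemma rel_poly_0: "rel_poly G 0 b \<Longrightarrow> b = 0"
  unfolding rel_poly_def by (intro poly_eqI partial_hom_unique[of 0]) (use partial_hom_0 in auto)

lemma partial_hom_poly:
  assumes "rel_poly G a b" "(x, y) \<in> G"
  shows "(poly a x, poly b y) \<in> G"
proof -
  define n where "n = max (degree a) (degree b)"
  have pw: "(x ^ i, y ^ i) \<in> G" for i
    by (induction i) (auto intro: partial_hom_1 partial_hom_mult assms)
  have *: "poly c z = (\<Sum>i\<le>n. coeff c i * z ^ i)" if "degree c \<le> n" for c :: "'k poly" and z
    unfolding poly_altdef using that by (intro sum.mono_neutral_left) (auto simp: coeff_eq_0)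
  have "(\<Sum>i\<le>n. coeff a i * x ^ i, \<Sum>i\<le>n. coeff b i * y ^ i) \<in> G"
    using assms(1) by (intro partial_hom_sum partial_hom_mult pw) (auto simp: rel_poly_def)
  then show ?thesis by (simp add: * n_def)
qed

text \<open>An annihilating polynomial of \<open>x\<close> over the base field of least degree has
  nonzero constant term, which expresses 1/x as a polynomial in \<open>x\<close>. The same
  polynomial evaluated at \<open>y\<close> gives the image.\<close>

lemma partial_hom_inverse:
  assumes xy: "(x, y) \<in> G" and x: "x \<noteq> 0"
  shows "(inverse x, inverse y) \<in> G"
proof -
  obtain f0 where "f0 \<noteq> 0" "poly (hom_poly f0) x = 0"
    using separable_annihilator[of x] .
  then obtain f where f: "f \<noteq> 0" "poly (hom_poly f) x = 0"
    and least: "\<And>h. h \<noteq> 0 \<Longrightarrow> poly (hom_poly h) x = 0 \<Longrightarrow> degree f \<le> degree h"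
    using ex_has_least_nat[of "\<lambda>f. f \<noteq> 0 \<and> poly (hom_poly f) x = 0" f0 degree] by blast
  obtain c f1 where c: "f = pCons c f1" by (cases f)
  have fx: "iota c + x * poly (hom_poly f1) x = 0" using f(2) by (simp add: c hom_poly_pCons)
  have c0: "c \<noteq> 0"
  proof
    assume "c = 0"
    then have "f1 \<noteq> 0" "poly (hom_poly f1) x = 0" using f(1) fx x c by auto
    then have "degree f \<le> degree f1" by (rule least)
    then show False using \<open>f1 \<noteq> 0\<close> by (simp add: c)
  qed
  define g where "g = smult (- inverse c) f1"
  have "x * poly (hom_poly g) x = 1"
  proof -
    have "iota c * (x * poly (hom_poly g) x) = - (x * poly (hom_poly f1) x)"
      unfolding g_def hom_poly_smult poly_smult hom_minus hom_inverse using c0 by simp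
    also have "\<dots> = iota c * 1" using fx by (simp add: neg_eq_iff_add_eq_0 add.commute)
    finally show ?thesis using c0 by (metis mult_left_cancel hom_eq_0_iff)
  qed
  then have inv: "inverse x = poly (hom_poly g) x" by (rule inverse_unique)
  define u where "u = poly (hom_poly g) y"
  have xu: "(inverse x, u) \<in> G"
    unfolding inv u_def by (intro partial_hom_poly rel_poly_hom_poly xy)
  have "(x * inverse x, y * u) \<in> G" by (intro partial_hom_mult xy xu)
  then have "y * u = 1" using x partial_hom_1 partial_hom_unique by simp
  then have "inverse y = u" by (rule inverse_unique)
  then show ?thesis using xu by simp
qed

lemma rel_poly_degree:
  assumes "rel_poly G a b"
  shows "degree a = degree b"
proof (rule antisym)
  have *: "coeff a i = 0 \<longleftrightarrow> coeff b i = 0" for i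
  proof
    assume "coeff a i = 0"
    then show "coeff b i = 0"
      using assms partial_hom_0 partial_hom_unique unfolding rel_poly_def by metis
  next
    assume b: "coeff b i = 0"
    show "coeff a i = 0"
    proof (rule ccontr)
      assume "coeff a i \<noteq> 0"
      then have "(coeff a i * inverse (coeff a i), coeff b i * inverse (coeff b i)) \<in> G"
        using assms by (intro partial_hom_mult partial_hom_inverse) (auto simp: rel_poly_def)
      then show False
        using b \<open>coeff a i \<noteq> 0\<close> partial_hom_1 partial_hom_unique by fastforce
    qed
  qed
  show "degree a \<le> degree b" by (rule degree_le) (simp add: * coeff_eq_0)
  show "degree b \<le> degree a" by (rule degree_le) (simp flip: * add: coeff_eq_0)
qed

text \<open>Long division is run on both polynomials in parallel, each quotient term being a related
  pair of monomials.\<close>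

lemma rel_poly_division:
  assumes m: "rel_poly G m m'" "lead_coeff m = 1"
  shows "rel_poly G a b \<Longrightarrow> \<exists>q q' r r'. rel_poly G q q' \<and> rel_poly G r r' \<and>
    a = m * q + r \<and> b = m' * q' + r' \<and> (r = 0 \<or> degree r < degree m)"
proof (induction "degree a" arbitrary: a b rule: less_induct)
  case less
  show ?case
  proof (cases "a = 0 \<or> degree a < degree m")
    case True
    have "rel_poly G 0 0" by (simp add: rel_poly_def partial_hom_0)
    then show ?thesis using True less.prems by (intro exI[of _ 0] exI[of _ a] exI[of _ b]) auto
  next
    case False
    define n where "n = degree a - degree m"
    define c where "c = monom (coeff a (degree a)) n"
    define c' where "c' = monom (coeff b (degree a)) n"
    have cc: "rel_poly G c c'" using less.prems unfolding c_def c'_def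
      by (intro rel_poly_monom) (auto simp: rel_poly_def)
    define a1 where "a1 = a - m * c"
    define b1 where "b1 = b - m' * c'"
    have rel1: "rel_poly G a1 b1"
      unfolding a1_def b1_def by (intro rel_poly_diff rel_poly_mult less.prems m cc)
    have c0: "c \<noteq> 0" using False by (simp add: c_def)
    have degc: "degree (m * c) = degree a"
      using False c0 m(2) by (subst degree_mult_eq) (auto simp: c_def degree_monom_eq n_def)
    have "lead_coeff (m * c) = lead_coeff a"
      unfolding lead_coeff_mult using False m(2) by (simp add: c_def degree_monom_eq)
    then have top: "coeff a1 (degree a) = 0" unfolding a1_def using degc by simp
    have dega1: "degree a1 \<le> degree a"
      unfolding a1_def by (rule degree_diff_le) (auto simp: degc)
    show ?thesis
    proof (cases "a1 = 0")
      case True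
      have "b1 = 0" using rel1 True rel_poly_0 by simp
      have "rel_poly G 0 0" by (simp add: rel_poly_def partial_hom_0)
      then show ?thesis using True \<open>b1 = 0\<close> cc unfolding a1_def b1_def
        by (intro exI[of _ c] exI[of _ c'] exI[of _ 0]) auto
    next
      case False
      then have "degree a1 < degree a"
        using top dega1 by (metis le_neq_implies_less leading_coeff_0_iff)
      then obtain q q' r r' where qr: "rel_poly G q q'" "rel_poly G r r'" "a1 = m * q + r"
          "b1 = m' * q' + r'" "r = 0 \<or> degree r < degree m"
        using less.hyps[OF _ rel1] by blast
      have "a = m * (q + c) + r" "b = m' * (q' + c') + r'"
        using qr(3,4) by (auto simp: a1_def b1_def algebra_simps)
      then show ?thesis using qr cc rel_poly_add by blast
    qed
  qed
qed

text \<open>\<open>m\<close> is the minimal polynomial of \<open>z\<close> over the domain of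
  \<open>G\<close>, and \<open>m'\<close> its image. A separable polynomial over the base field that
  kills \<open>z\<close> is related to itself, so both \<open>m\<close> and \<open>m'\<close> divide
  it and inherit separability.\<close>

lemma minimal_polynomial:
  obtains m m' where "rel_poly G m m'" "lead_coeff m = 1" "poly m z = 0" "degree m \<ge> 1"
    "coprime m (pderiv m)" "coprime m' (pderiv m')"
    "\<forall>a b. rel_poly G a b \<longrightarrow> poly a z = 0 \<longrightarrow> m' dvd b"
proof -
  obtain f where f: "f \<noteq> 0" "coprime f (pderiv f)" "poly (hom_poly f) z = 0"
    using separable_annihilator[of z] .
  define P where "P = (\<lambda>m. m \<noteq> 0 \<and> poly m z = 0 \<and> (\<exists>m'. rel_poly G m m'))"
  have "P (hom_poly f)" using f rel_poly_hom_poly by (auto simp: P_def)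
  then obtain m0 where m0: "P m0" and least: "\<And>h. P h \<Longrightarrow> degree m0 \<le> degree h"
    using ex_has_least_nat[of P "hom_poly f" degree] by blast
  obtain m0' where m0': "rel_poly G m0 m0'" using m0 by (auto simp: P_def)
  define m where "m = smult (inverse (lead_coeff m0)) m0"
  define m' where "m' = smult (inverse (coeff m0' (degree m0))) m0'"
  have m0nz: "m0 \<noteq> 0" using m0 by (simp add: P_def)
  have rel: "rel_poly G m m'"
    unfolding m_def m'_def using m0' m0nz
    by (intro rel_poly_smult partial_hom_inverse) (auto simp: rel_poly_def)
  have lc: "lead_coeff m = 1" and mz: "poly m z = 0" and degm: "degree m = degree m0"
    using m0 m0nz by (auto simp: m_def P_def)
  have dvd: "m dvd a \<and> m' dvd b" if ab: "rel_poly G a b" "poly a z = 0" for a b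
  proof -
    obtain q q' r r' where qr: "rel_poly G q q'" "rel_poly G r r'" "a = m * q + r"
        "b = m' * q' + r'" "r = 0 \<or> degree r < degree m"
      using rel_poly_division[OF rel lc ab(1)] by blast
    have "poly r z = 0" using ab(2) mz by (simp add: qr(3))
    have "r = 0"
    proof (rule ccontr)
      assume "r \<noteq> 0"
      then have "P r" using qr(2) \<open>poly r z = 0\<close> by (auto simp: P_def)
      then show False using least[of r] qr(5) degm \<open>r \<noteq> 0\<close> by simp
    qed
    then have "r' = 0" using qr(2) rel_poly_0 by simp
    then show ?thesis using qr \<open>r = 0\<close> by simp
  qed
  have "m dvd hom_poly f" "m' dvd hom_poly f"
    using dvd[OF rel_poly_hom_poly f(3)] by auto
  then have "coprime m (pderiv m)" "coprime m' (pderiv m')"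
    using hom_poly_coprime_pderiv[OF f(2,1)] separable_dvd by blast+
  moreover have "degree m \<ge> 1"
  proof (rule ccontr)
    assume "\<not> degree m \<ge> 1"
    then have "m = 1" using lc by (auto elim!: degree_eq_zeroE simp: not_le)
    then show False using mz by simp
  qed
  ultimately show ?thesis using that[of m m'] rel lc mz dvd by blast
qed

text \<open>\<open>ext\<close> makes the extension well defined: two representations of one element
  differ by a polynomial vanishing at \<open>z\<close>, whose image vanishes at
  \<open>z'\<close>.\<close>

lemma partial_hom_adjoin:
  assumes ext: "\<forall>a b. rel_poly G a b \<longrightarrow> poly a z = 0 \<longrightarrow> poly b z' = 0"
  shows "partial_hom (adjoin G z z')" "G \<subseteq> adjoin G z z'" "(z, z') \<in> adjoin G z z'"
proof -
  have const: "(x, y) \<in> adjoin G z z'" if "(x, y) \<in> G" for x y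
    unfolding adjoin_def using rel_poly_monom[OF that, of 0]
    by (intro CollectI exI[of _ "monom x 0"] exI[of _ "monom y 0"]) (simp add: poly_monom)
  then show "G \<subseteq> adjoin G z z'" by auto
  show "(z, z') \<in> adjoin G z z'"
    unfolding adjoin_def using rel_poly_monom[OF partial_hom_1, of 1]
    by (intro CollectI exI[of _ "monom 1 1"]) (simp add: poly_monom)
  show "partial_hom (adjoin G z z')"
    unfolding partial_hom_def
  proof (intro conjI allI impI)
    fix c show "(iota c, iota c) \<in> adjoin G z z'" by (rule const[OF partial_hom_base])
  next
    fix x y x' y' assume "(x, y) \<in> adjoin G z z'" "(x', y') \<in> adjoin G z z'"
    then obtain a b a' b' where ab: "rel_poly G a b" "rel_poly G a' b'" 
      "x = poly a z" "y = poly b z'" "x' = poly a' z" "y' = poly b' z'"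
      by (auto simp: adjoin_def)
    show "(x + x', y + y') \<in> adjoin G z z'"
      unfolding adjoin_def ab(3-) using rel_poly_add[OF ab(1,2)] by (auto simp flip: poly_add)
    show "(x * x', y * y') \<in> adjoin G z z'"
      unfolding adjoin_def ab(3-) using rel_poly_mult[OF ab(1,2)] by (auto simp flip: poly_mult)
  next
    fix x y y' assume "(x, y) \<in> adjoin G z z'" "(x, y') \<in> adjoin G z z'"
    then obtain a b a' b' where ab: "rel_poly G a b" "rel_poly G a' b'" 
      "x = poly a z" "y = poly b z'" "x = poly a' z" "y' = poly b' z'"
      by (auto simp: adjoin_def)
    have "poly (b - b') z' = 0"
      using ext rel_poly_diff[OF ab(1,2)] ab(3,5) by (metis diff_self poly_diff)
    then show "y = y'" using ab by simp
  qed
qed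

end

text \<open>A maximal partial homomorphism from Zorn's lemma is total: any \<open>z\<close> can be
  sent to a root of the image of its minimal polynomial, and separable closedness supplies that
  root. It is onto because it permutes the finite root set of every nonzero polynomial over the base
  field.\<close>

lemma galois_elem_extends:
  assumes G0: "partial_hom G0"
  obtains \<sigma> where "galois_elem iota \<sigma>" "\<And>x y. (x, y) \<in> G0 \<Longrightarrow> \<sigma> x = y"
proof -
  define \<A> where "\<A> = {G. partial_hom G \<and> G0 \<subseteq> G}"
  have "\<exists>M\<in>\<A>. \<forall>X\<in>\<A>. M \<subseteq> X \<longrightarrow> X = M"
  proof (rule subset_Zorn_nonempty)
    show "\<A> \<noteq> {}" using G0 by (auto simp: \<A>_def)
  next
    fix \<C> assume \<C>: "\<C> \<noteq> {}" "subset.chain \<A> \<C>"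
    have mem: "G \<in> \<A>" if "G \<in> \<C>" for G using \<C>(2) that by (auto simp: subset.chain_def)
    have common: "\<exists>G\<in>\<C>. p \<in> G \<and> q \<in> G" if pq: "p \<in> \<Union>\<C>" "q \<in> \<Union>\<C>" for p q
    proof -
      obtain G H where "G \<in> \<C>" "H \<in> \<C>" "p \<in> G" "q \<in> H" using pq by blast
      moreover have "G \<subseteq> H \<or> H \<subseteq> G" using \<C>(2) \<open>G \<in> \<C>\<close> \<open>H \<in> \<C>\<close> by (auto simp: subset.chain_def)
      ultimately show ?thesis by blast
    qed
    have "partial_hom (\<Union>\<C>)"
      unfolding partial_hom_def
    proof (intro conjI allI impI)
      fix c show "(iota c, iota c) \<in> \<Union>\<C>"
        using \<C>(1) mem partial_hom_base by (fastforce simp: \<A>_def)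
    next
      fix x y x' y' assume "(x, y) \<in> \<Union>\<C>" "(x', y') \<in> \<Union>\<C>"
      then obtain G where "G \<in> \<C>" "(x, y) \<in> G" "(x', y') \<in> G" using common by blast
      moreover have "partial_hom G" using \<open>G \<in> \<C>\<close> mem by (auto simp: \<A>_def)
      ultimately show "(x + x', y + y') \<in> \<Union>\<C>" "(x * x', y * y') \<in> \<Union>\<C>"
        using partial_hom_add partial_hom_mult by blast+
    next
      fix x y y' assume "(x, y) \<in> \<Union>\<C>" "(x, y') \<in> \<Union>\<C>"
      then obtain G where "G \<in> \<C>" "(x, y) \<in> G" "(x, y') \<in> G" using common by blast
      moreover have "partial_hom G" using \<open>G \<in> \<C>\<close> mem by (auto simp: \<A>_def)
      ultimately show "y = y'" using partial_hom_unique by blast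
    qed
    moreover have "G0 \<subseteq> \<Union>\<C>" using \<C>(1) mem by (fastforce simp: \<A>_def)
    ultimately show "\<Union>\<C> \<in> \<A>" by (simp add: \<A>_def)
  qed
  then obtain M where M: "partial_hom M" "G0 \<subseteq> M"
    and max: "\<And>X. partial_hom X \<Longrightarrow> M \<subseteq> X \<Longrightarrow> X = M"
    by (elim bexE, unfold \<A>_def) (metis (no_types, lifting) mem_Collect_eq order.trans)
  have total: "\<exists>y. (z, y) \<in> M" for z
  proof -
    obtain m m' where m: "rel_poly M m m'" "lead_coeff m = 1" "poly m z = 0" "degree m \<ge> 1"
        "coprime m (pderiv m)" "coprime m' (pderiv m')"
        and dvd: "\<forall>a b. rel_poly M a b \<longrightarrow> poly a z = 0 \<longrightarrow> m' dvd b"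
      using minimal_polynomial[OF M(1), of z] .
    have "degree m' \<ge> 1" using m(4) rel_poly_degree[OF M(1) m(1)] by simp
    then obtain z' where z': "poly m' z' = 0" using separable_root m(6) by blast
    have "\<forall>a b. rel_poly M a b \<longrightarrow> poly a z = 0 \<longrightarrow> poly b z' = 0"
      using z' dvd by (metis dvd_trans poly_eq_0_iff_dvd)
    note adj = partial_hom_adjoin[where z = z and z' = z', OF M(1) this]
    show ?thesis using max[OF adj(1,2)] adj(3) by auto
  qed
  then obtain \<sigma> where \<sigma>: "\<And>z. (z, \<sigma> z) \<in> M" by metis
  have \<sigma>_eq: "\<sigma> x = y" if "(x, y) \<in> M" for x y
    using partial_hom_unique[OF M(1) \<sigma> that] .
  have hom\<sigma>: "is_field_hom \<sigma>"
    unfolding is_field_hom_def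
    using \<sigma> by (auto intro!: \<sigma>_eq partial_hom_1[OF M(1)] partial_hom_add[OF M(1)] partial_hom_mult[OF M(1)])
  interpret \<sigma>: field_hom \<sigma> by unfold_locales (rule hom\<sigma>)
  have fix_base: "\<sigma> (iota c) = iota c" for c by (rule \<sigma>_eq[OF partial_hom_base[OF M(1)]])
  have "surj \<sigma>"
  proof -
    have "\<exists>x. y = \<sigma> x" for y
    proof -
      obtain f where f: "f \<noteq> 0" "poly (hom_poly f) y = 0"
        using separable_annihilator[of y] .
      define S where "S = {x. poly (hom_poly f) x = 0}"
      have "finite S" unfolding S_def using f by (intro poly_roots_finite) simp
      moreover have "\<sigma> ` S \<subseteq> S"
      proof (rule image_subsetI)
        fix x assume "x \<in> S"
        have "map_poly \<sigma> (hom_poly f) = hom_poly f"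
          by (rule poly_eqI) (simp add: fix_base)
        then have "poly (hom_poly f) (\<sigma> x) = \<sigma> (poly (hom_poly f) x)"
          using \<sigma>.poly_hom_poly[of "hom_poly f" x] by simp
        then show "\<sigma> x \<in> S" using \<open>x \<in> S\<close> by (simp add: S_def)
      qed
      moreover have "inj_on \<sigma> S" by (rule inj_onI) simp
      ultimately have "\<sigma> ` S = S" by (rule endo_inj_surj)
      then show ?thesis using f(2) by (auto simp: S_def)
    qed
    then show ?thesis by (auto simp: surj_def)
  qed
  moreover have "inj \<sigma>" by (rule injI) simp
  ultimately have "galois_elem iota \<sigma>"
    using hom\<sigma> fix_base by (simp add: galois_elem_def bij_def)
  then show ?thesis using that \<sigma>_eq M(2) by blast
qed

section \<open>Conjugates and fixed fields over the base field\<close>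

definition base_graph :: "('k \<times> 'k) set" where
  "base_graph = {(iota c, iota c) |c. True}"

lemma partial_hom_base_graph: "partial_hom base_graph"
  unfolding partial_hom_def base_graph_def by (auto simp flip: hom_add hom_mult)

lemma rel_poly_base_graph:
  assumes "rel_poly base_graph a b"
  obtains f where "a = hom_poly f" "b = hom_poly f"
proof -
  have "\<forall>i. \<exists>c. coeff a i = iota c \<and> coeff b i = iota c"
    using assms by (auto simp: rel_poly_def base_graph_def)
  then obtain c where c: "\<And>i. coeff a i = iota (c i)" "\<And>i. coeff b i = iota (c i)" by metis
  define f where "f = Poly (map c [0..<Suc (degree a)])"
  have "coeff f i = c i" for i
  proof (cases "i \<le> degree a")
    case False
    then have "coeff a i = 0" by (simp add: coeff_eq_0)
    then have "c i = 0" using c(1)[of i] by simp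
    then show ?thesis using False by (auto simp: f_def nth_default_def simp del: upt_Suc)
  qed (auto simp: f_def nth_default_def simp del: upt_Suc)
  then have "a = hom_poly f" "b = hom_poly f" by (auto intro!: poly_eqI simp: c)
  then show ?thesis by (rule that)
qed

lemma galois_elem_conjugate:
  assumes "\<And>f. poly (hom_poly f) t = 0 \<Longrightarrow> poly (hom_poly f) t' = 0"
  obtains \<sigma> where "galois_elem iota \<sigma>" "\<sigma> t = t'"
proof -
  have "\<forall>a b. rel_poly base_graph a b \<longrightarrow> poly a t = 0 \<longrightarrow> poly b t' = 0"
    using rel_poly_base_graph assms by metis
  note adj = partial_hom_adjoin[where z = t and z' = t', OF partial_hom_base_graph this]
  show ?thesis using galois_elem_extends[OF adj(1)] adj(3) that by metis
qed

text \<open>Over the ring F[t], on which \<open>E\<close> is the identity, the minimal polynomial of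
  \<open>x\<close> is separable. If its degree exceeded 1, it would have a second root
  \<open>z\<close>, and x |-> z would extend to an automorphism fixing \<open>t\<close> and moving
  \<open>x\<close>.\<close>

lemma fixed_field_simple:
  assumes fixed: "\<And>\<sigma>. galois_elem iota \<sigma> \<Longrightarrow> \<sigma> t = t \<Longrightarrow> \<sigma> x = x"
  obtains f where "x = poly (hom_poly f) t"
proof -
  define E where "E = adjoin base_graph t t"
  have "\<forall>a b. rel_poly base_graph a b \<longrightarrow> poly a t = 0 \<longrightarrow> poly b t = 0"
    using rel_poly_base_graph by metis
  note adj = partial_hom_adjoin[where z = t and z' = t, OF partial_hom_base_graph this, folded E_def]
  have E_Id: "z = y \<and> (\<exists>f. z = poly (hom_poly f) t)" if "(z, y) \<in> E" for z y
    using that unfolding E_def adjoin_def by (auto elim!: rel_poly_base_graph)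
  have rel_Id: "a = b" if "rel_poly E a b" for a b
    using that E_Id by (auto simp: rel_poly_def intro!: poly_eqI)
  obtain m m' where m: "rel_poly E m m'" "lead_coeff m = 1" "poly m x = 0" "degree m \<ge> 1"
      "coprime m (pderiv m)" "coprime m' (pderiv m')"
      and dvd: "\<forall>a b. rel_poly E a b \<longrightarrow> poly a x = 0 \<longrightarrow> m' dvd b"
    using minimal_polynomial[OF adj(1), of x] .
  have mm: "m' = m" using rel_Id[OF m(1)] by simp
  obtain n where n: "m = [:- x, 1:] * n" using m(3) by (auto simp: poly_eq_0_iff_dvd elim!: dvdE)
  have "degree n = 0"
  proof (rule ccontr)
    assume "degree n \<noteq> 0"
    moreover have "coprime n (pderiv n)" using m(5) by (rule separable_dvd) (simp only: n dvd_triv_right)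
    ultimately obtain z where z: "poly n z = 0" using separable_root[of n] by auto
    have "z \<noteq> x"
    proof
      assume "z = x"
      then have "poly n x = 0" using z by simp
      then have "poly (pderiv m) x = 0" by (simp add: n pderiv_mult pderiv_pCons del: mult_pCons_left)
      then have "[:- x, 1:] dvd m" "[:- x, 1:] dvd pderiv m" using m(3) by (auto simp: poly_eq_0_iff_dvd)
      then have "is_unit [:- x, 1:]" using m(5) by (blast intro: coprime_common_divisor)
      then show False by (auto simp: is_unit_iff_degree)
    qed
    have "\<forall>a b. rel_poly E a b \<longrightarrow> poly a x = 0 \<longrightarrow> poly b z = 0"
      using z dvd by (metis mm n dvd_trans dvd_triv_right poly_eq_0_iff_dvd)
    note adj2 = partial_hom_adjoin[where z = x and z' = z, OF adj(1) this]
    obtain \<sigma> where "galois_elem iota \<sigma>" and \<sigma>: "\<And>x' y. (x', y) \<in> adjoin E x z \<Longrightarrow> \<sigma> x' = y"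
      using galois_elem_extends[OF adj2(1)] by blast
    moreover have "\<sigma> t = t" using \<sigma> adj(3) adj2(2) by blast
    moreover have "\<sigma> x = z" using \<sigma> adj2(3) by blast
    ultimately show False using fixed \<open>z \<noteq> x\<close> by metis
  qed
  then obtain c where "n = [:c:]" by (auto elim!: degree_eq_zeroE)
  moreover from this have "c = 1" using m(2) by (simp add: n split: if_splits)
  ultimately have "m = [:- x, 1:]" by (simp add: n)
  moreover have "(coeff m 0, coeff m 0) \<in> E" using m(1) mm by (simp add: rel_poly_def)
  ultimately have "(- x, - x) \<in> E" by simp
  then have "(x, x) \<in> E" using partial_hom_minus[OF adj(1)] by fastforce
  then show ?thesis using E_Id that by blast
qed

end

section \<open>Linear recurring sequences and their eigenvectors\<close>

lemma embA_simps [simp]: "embA 0 = 0" "embA 1 = 1"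
  and embA_add: "embA (a + b) = embA a + embA b"
  and embA_mult: "embA (a * b) = embA a * embA b"
  and embA_eq_0_iff [simp]: "embA a = 0 \<longleftrightarrow> a = 0"
  by (simp_all add: embA_def Fract_of_int_eq eq_fract One_fract_def Zero_fract_def)

context char2_field
begin

lemma frob_funpow_add: "(frob_poly ^^ n) ((p::'a poly) + q) = (frob_poly ^^ n) p + (frob_poly ^^ n) q"
  by (induction n) (auto simp: frob_poly_add)

lemma frob_funpow_mult: "(frob_poly ^^ n) ((p::'a poly) * q) = (frob_poly ^^ n) p * (frob_poly ^^ n) q"
  by (induction n) (auto simp: frob_poly_mult)

lemma frob_funpow_smult: "(frob_poly ^^ n) (smult c (p::'a poly)) = smult (c ^ (2 ^ n)) ((frob_poly ^^ n) p)"
  by (induction n) (auto simp: frob_poly_smult mult.commute simp flip: power_mult)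

lemma frob_funpow_fixed: "frob_poly (p::'a poly) = p \<Longrightarrow> (frob_poly ^^ n) p = p"
  by (induction n) auto

lemma frob_funpow_eq_0_iff [simp]: "(frob_poly ^^ n) (p::'a poly) = 0 \<longleftrightarrow> p = 0"
  by (induction n) auto

lemma frob_funpow_0 [simp]: "(frob_poly ^^ n) (0::'a poly) = 0"
  by (induction n) auto

lemma frob_poly_prod: "frob_poly (prod f A) = (\<Prod>i\<in>A. frob_poly (f i :: 'a poly))"
  by (induction A rule: infinite_finite_induct) (auto simp: frob_poly_mult)

lemma frob_funpow_inj: "(x::'a) ^ (2 ^ n) = y ^ (2 ^ n) \<Longrightarrow> x = y"
proof (induction n arbitrary: x y)
  case (Suc n)
  have "(x ^ (2 ^ n))^2 = (y ^ (2 ^ n))^2" using Suc.prems by (simp add: mult.commute flip: power_mult)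
  then show ?case using Suc.IH square_inj by blast
qed simp

end

text \<open>The linear functional on polynomials that sends x^j to y_j; elements of the torsion
  module tensored with K appear as its values.\<close>

definition pairing :: "(nat \<Rightarrow> 'k) \<Rightarrow> 'k::field poly \<Rightarrow> 'k" where
  "pairing y h = (\<Sum>j\<le>degree h. coeff h j * y j)"

lemma pairing_altdef: "degree h \<le> n \<Longrightarrow> pairing y h = (\<Sum>j\<le>n. coeff h j * y j)"
  unfolding pairing_def by (intro sum.mono_neutral_left) (auto simp: coeff_eq_0)

lemma pairing_0 [simp]: "pairing y 0 = 0"
  by (simp add: pairing_def)

lemma pairing_zero_fun [simp]: "pairing (\<lambda>_. 0) h = 0"
  by (simp add: pairing_def)

lemma pairing_add: "pairing y (a + b) = pairing y a + pairing y b"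
proof -
  define n where "n = max (degree a) (degree b)"
  have "degree (a + b) \<le> n" "degree a \<le> n" "degree b \<le> n"
    by (auto simp: n_def intro: degree_add_le)
  then show ?thesis by (simp add: pairing_altdef[of _ n] sum.distrib distrib_right)
qed

lemma pairing_smult: "pairing y (smult c a) = c * pairing y a"
proof -
  have "degree (smult c a) \<le> degree a" by simp
  then show ?thesis by (simp add: pairing_altdef[of _ "degree a"] sum_distrib_left mult.assoc)
qed

lemma pairing_pCons: "pairing y (pCons c h) = c * y 0 + pairing (\<lambda>j. y (Suc j)) h"
proof -
  have "degree (pCons c h) \<le> Suc (degree h)" by simp
  then have "pairing y (pCons c h) = (\<Sum>j\<le>Suc (degree h). coeff (pCons c h) j * y j)"
    by (rule pairing_altdef)
  also have "\<dots> = c * y 0 + (\<Sum>j\<le>degree h. coeff h j * y (Suc j))"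
    by (subst sum.atMost_Suc_shift) simp
  finally show ?thesis by (simp add: pairing_def)
qed

text \<open>Multiplication by x^n shifts the sequence by n. Hence the functional kills all multiples
  of \<open>a\<close> once \<open>a\<close> pairs to 0 with every shift.\<close>

lemma pairing_mult: "pairing y (a * b) = pairing (\<lambda>n. pairing (\<lambda>i. y (i + n)) a) b"
proof (induction b arbitrary: y)
  case (pCons c b)
  have "a * pCons c b = smult c a + pCons 0 (a * b)" by simp
  then have "pairing y (a * pCons c b) = c * pairing y a + pairing (\<lambda>j. y (Suc j)) (a * b)"
    by (simp only: pairing_add pairing_smult pairing_pCons) simp
  then show ?case by (simp add: pairing_pCons pCons.IH)
qed simp

lemma (in field_hom) hom_pairing:
  fixes y :: "nat \<Rightarrow> 'b"
  shows "iota (pairing y h) = pairing (\<lambda>j. iota (y j)) (hom_poly h)"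
  by (simp add: pairing_def hom_sum hom_mult)

lemma poly_division_linear:
  fixes q :: "'k::field poly"
  obtains k where "q = [:- t, 1:] * k + [:poly q t:]"
proof -
  have "poly (q - [:poly q t:]) t = 0" by simp
  then have "[:- t, 1:] dvd q - [:poly q t:]" by (simp only: poly_eq_0_iff_dvd)
  then obtain k where "q - [:poly q t:] = [:- t, 1:] * k" ..
  then have "q = [:- t, 1:] * k + [:poly q t:]" by (simp only: diff_eq_eq)
  then show ?thesis by (rule that)
qed

text \<open>Since y annihilates the ideal generated by P, evaluation at h only depends on residues modulo P,
  and h spans the eigenspace for t in that quotient.\<close>

lemma pairing_eigenvector:
  assumes "\<And>q. pairing y (P * q) = 0" "P = [:- t, 1:] * h"
  shows "pairing y (h * q) = poly q t * pairing y h"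
proof -
  obtain k where k: "q = [:- t, 1:] * k + [:poly q t:]" by (rule poly_division_linear)
  have "h * q = P * k + smult (poly q t) h"
    by (subst k, subst assms(2)) (simp add: algebra_simps)
  then show ?thesis by (simp add: pairing_add pairing_smult assms(1))
qed

lemma bit_square: "(c::bit)^2 = c"
  by (cases c) auto

interpretation bit: char2_field "TYPE(bit)"
  by unfold_locales simp

lemma frob_poly_bit: "frob_poly (p :: bit poly) = p"
  by (rule poly_eqI) (simp add: bit_square)

text \<open>F_2 is perfect: zero derivative would make \<open>p\<close> a square, and a nonzero
  derivative has too small a degree to be divisible by \<open>p\<close>.\<close>

lemma irreducible_separable_bit:
  assumes "irreducible (p::bit poly)"
  shows "coprime p (pderiv p)"
proof (rule coprimeI)
  fix d assume d: "d dvd p" "d dvd pderiv p"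
  have p0: "p \<noteq> 0" using assms by auto
  show "is_unit d"
  proof (rule ccontr)
    assume "\<not> is_unit d"
    obtain e where e: "p = d * e" using d(1) ..
    then have "is_unit e" using assms \<open>\<not> is_unit d\<close> by (auto dest: irreducibleD)
    then have "p dvd d" using e by (metis dvd_mult_unit_iff dvd_refl)
    then have pd: "p dvd pderiv p" using d(2) dvd_trans by blast
    have nu: "\<not> is_unit p" using assms by (rule irreducible_not_unit)
    then have "degree p \<noteq> 0" using p0 by (simp add: is_unit_iff_degree)
    then have "degree (pderiv p) < degree p" using bit.degree_pderiv_le[of p] by simp
    then have "pderiv p = 0" using pd dvd_imp_degree_le by (metis not_le)
    then obtain s where "p = s^2" using bit.frob_fixed_eq_square[OF frob_poly_bit] by metis
    then have "p = s * s" by (simp add: power2_eq_square)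
    then have "is_unit s" using assms by (metis irreducibleD)
    then show False using nu \<open>p = s * s\<close> unit_prod by blast
  qed
qed

section \<open>Finite constants in K and polynomials in T over them\<close>

context sep_closure
begin

sublocale char2_field "TYPE('k)"
proof
  have "(2::F) = embA 2" by (metis embA_add embA_simps(2) one_add_one)
  also have "(2 :: A) = 0" by simp
  finally have "(2::F) = 0" by simp
  then show "(2::'k) = 0" using hom_add[of 1 1] by (simp flip: hom_eq_0_iff)
qed

definition emb_bit :: "bit \<Rightarrow> 'k" where
  "emb_bit c = iota (embA [:c:])"

sublocale bit_hom: field_hom emb_bit
proof
  have "[:a:] * [:b:] = [:a * b:]" "[:a:] + [:b:] = [:a + b:]" for a b :: bit by auto
  then show "is_field_hom emb_bit"
    unfolding is_field_hom_def emb_bit_def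
    by (metis hom_1 hom_add hom_mult embA_simps(2) embA_add embA_mult one_pCons)
qed

abbreviation "T \<equiv> iota (embA Tvar)"

lemma poly_bit_hom_T: "poly (bit_hom.hom_poly h) T = iota (embA h)"
proof (induction h)
  case (pCons c h)
  have "pCons c h = [:c:] + Tvar * h" by (simp add: Tvar_def)
  then have "iota (embA (pCons c h)) = emb_bit c + T * iota (embA h)"
    by (simp add: embA_add embA_mult hom_add hom_mult emb_bit_def)
  then show ?case by (simp add: bit_hom.hom_poly_pCons pCons.IH)
qed simp

lemma frob_bit_hom [simp]: "frob_poly (bit_hom.hom_poly h) = bit_hom.hom_poly h"
  by (rule poly_eqI) (simp flip: bit_hom.hom_power add: bit_square)

lemma frob_fixed_bit_hom:
  assumes "frob_poly (H :: 'k poly) = H"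
  obtains h where "H = bit_hom.hom_poly h"
proof -
  define h :: "bit poly" where "h = map_poly (\<lambda>c. if c = 0 then 0 else 1) H"
  have "H = bit_hom.hom_poly h"
    by (rule poly_eqI) (use coeff_frob_fixed[OF assms] in \<open>force simp: h_def coeff_map_poly\<close>)
  then show ?thesis by (rule that)
qed

text \<open>The product of the Frobenius twists of H has coefficients in the prime field, so this reduces to
  the transcendence of T over the prime field.\<close>

lemma T_transcendental:
  assumes "(frob_poly ^^ n) (H :: 'k poly) = H" "n \<ge> 1" "poly H T = 0"
  shows "H = 0"
proof -
  define N where "N = (\<Prod>i<n. (frob_poly ^^ i) H)"
  have "frob_poly N = (\<Prod>i<n. (frob_poly ^^ Suc i) H)"
    by (simp add: N_def frob_poly_prod)
  also have "\<dots> = N"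
  proof -
    have "(\<Prod>i<Suc n. (frob_poly ^^ i) H) = H * (\<Prod>i<n. (frob_poly ^^ Suc i) H)"
      by (subst prod.lessThan_Suc_shift) simp
    moreover have "(\<Prod>i<Suc n. (frob_poly ^^ i) H) = H * N"
      by (simp add: N_def assms(1) mult.commute)
    ultimately show ?thesis by (cases "H = 0") (auto simp: N_def simp del: funpow.simps)
  qed
  finally obtain h where h: "N = bit_hom.hom_poly h" by (rule frob_fixed_bit_hom)
  have "H dvd N" unfolding N_def
    using assms(2) by (intro dvd_prodI[of _ 0, where f = "\<lambda>i. (frob_poly ^^ i) H", simplified]) auto
  then have "poly N T = 0" using assms(3) by (auto elim!: dvdE)
  then have "h = 0" unfolding h poly_bit_hom_T by simp
  then show "H = 0" using h by (auto simp: N_def)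
qed

lemma poly_bit_hom_square: "poly (bit_hom.hom_poly h) (x^2) = (poly (bit_hom.hom_poly h) x)^2"
proof (induction h)
  case (pCons c h)
  have "(emb_bit c)^2 = emb_bit c" by (simp flip: bit_hom.hom_power add: bit_square)
  then show ?case
    by (simp add: bit_hom.hom_poly_pCons pCons.IH square_add power_mult_distrib)
qed simp

text \<open>All t^(2^i) are roots of \<open>p\<close>, so two of them coincide; injectivity of
  Frobenius moves the coincidence back to \<open>t\<close>.\<close>

lemma root_periodic:
  assumes "p \<noteq> 0" "poly (bit_hom.hom_poly p) t = 0"
  obtains n where "n \<ge> 1" "t ^ (2 ^ n) = t"
proof -
  have root: "poly (bit_hom.hom_poly p) (t ^ (2 ^ i)) = 0" for i
  proof (induction i)
    case (Suc i)
    have "t ^ (2 ^ Suc i) = (t ^ (2 ^ i))^2" by (simp add: mult.commute flip: power_mult)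
    then show ?case using poly_bit_hom_square Suc by simp
  qed (use assms in simp)
  have "finite {x. poly (bit_hom.hom_poly p) x = 0}" using assms by (intro poly_roots_finite) simp
  then have "finite (range (\<lambda>i. t ^ (2 ^ i)))"
    by (rule finite_subset[rotated]) (use root in auto)
  then have "\<not> inj (\<lambda>i::nat. t ^ (2 ^ i))" using finite_imageD by blast
  then obtain i j :: nat where "i < j" "t ^ (2 ^ i) = t ^ (2 ^ j)"
    unfolding inj_def by (metis linorder_neqE_nat)
  then have "t ^ (2 ^ i) = (t ^ (2 ^ (j - i))) ^ (2 ^ i)" by (simp flip: power_mult power_add)
  then have "t = t ^ (2 ^ (j - i))" by (rule frob_funpow_inj)
  then show ?thesis using that[of "j - i"] \<open>i < j\<close> by simp
qed

text \<open>\<open>b\<close> is a common denominator of the coefficients of \<open>G\<close>, and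
  \<open>H\<close> collects b G(t) as a polynomial in T with coefficients fixed by the n-th
  Frobenius power. In each term a(T) t^i the coefficients of a lie in F_2, so replacing t by t^2
  amounts to twisting \<open>H\<close>.\<close>

lemma clear_denominators:
  assumes t: "t ^ (2 ^ n) = t"
  shows "\<exists>b H. b \<noteq> 0 \<and> (frob_poly ^^ n) H = H \<and>
    iota (embA b) * poly (hom_poly G) t = poly H T \<and>
    iota (embA b) * poly (hom_poly G) (t^2) = poly (frob_poly H) T"
proof (induction G)
  case 0
  then show ?case by (intro exI[of _ 1] exI[of _ 0]) simp
next
  case (pCons c G)
  then obtain b H where H: "b \<noteq> 0" "(frob_poly ^^ n) H = H"
    "iota (embA b) * poly (hom_poly G) t = poly H T"
    "iota (embA b) * poly (hom_poly G) (t^2) = poly (frob_poly H) T" by blast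
  obtain a b1 where c: "c = Fract a b1" "b1 \<noteq> 0" by (cases c) auto
  have "embA b1 * c = embA a" using c by (simp add: embA_def eq_fract)
  then have bc: "iota (embA b1) * iota c = iota (embA a)" by (simp flip: hom_mult)
  define H' where "H' = bit_hom.hom_poly (b * a) + smult t (bit_hom.hom_poly b1 * H)"
  have fH': "frob_poly H' = bit_hom.hom_poly (b * a) + smult (t^2) (bit_hom.hom_poly b1 * frob_poly H)"
    unfolding H'_def frob_poly_add frob_poly_smult frob_poly_mult by simp
  have *: "iota (embA (b * b1)) * poly (hom_poly (pCons c G)) x =
      iota (embA b) * (iota (embA b1) * iota c) + x * (iota (embA b1) * (iota (embA b) * poly (hom_poly G) x))" for x
    by (simp add: hom_poly_pCons embA_mult hom_mult algebra_simps)
  show ?case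
  proof (intro exI conjI)
    show "b * b1 \<noteq> 0" using H c by simp
    show "(frob_poly ^^ n) H' = H'"
      unfolding H'_def frob_funpow_add frob_funpow_smult frob_funpow_mult
      by (simp add: frob_funpow_fixed t H(2))
    show "iota (embA (b * b1)) * poly (hom_poly (pCons c G)) t = poly H' T"
      unfolding * bc H(3) H'_def by (simp add: poly_bit_hom_T embA_mult hom_mult)
    show "iota (embA (b * b1)) * poly (hom_poly (pCons c G)) (t^2) = poly (frob_poly H') T"
      unfolding * bc H(4) fH' by (simp add: poly_bit_hom_T embA_mult hom_mult)
  qed
qed

text \<open>If G(t) = 0, then transcendence of T makes the cleared polynomial \<open>H\<close> zero,
  hence also its twist, which computes the value at t^2.\<close>

lemma conjugate_root:
  assumes t: "t ^ (2 ^ n) = t" "n \<ge> 1" and G: "poly (hom_poly G) t = 0"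
  shows "poly (hom_poly G) (t^2) = 0"
proof -
  obtain b H where "b \<noteq> 0" "(frob_poly ^^ n) H = H"
    "iota (embA b) * poly (hom_poly G) t = poly H T"
    "iota (embA b) * poly (hom_poly G) (t^2) = poly (frob_poly H) T"
    using clear_denominators[OF t(1)] by blast
  moreover from this have "H = 0" using T_transcendental[OF _ t(2)] G by simp
  ultimately show ?thesis by simp
qed

text \<open>Squaring a pairing squares the coefficients along with the sequence. So the terms of
  exponent 1, 2 and 4 in the recurrence are paired with \<open>h\<close> twisted twice, once and not
  at all, which gives all of them the same coefficients.\<close>

lemma pairing_twist:
  assumes rec: "\<And>j. y (Suc j) = T * y j + \<gamma> * (y j)^2 + (y j)^4"
  shows "pairing y (pCons 0 (frob_poly (frob_poly h))) =
    T * pairing y (frob_poly (frob_poly h)) + \<gamma> * (pairing y (frob_poly h))^2 + (pairing y h)^4"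
proof -
  have "((pairing y h)^2)^2 = (\<Sum>j\<le>degree h. (coeff h j)^4 * (y j)^4)"
    by (simp add: pairing_def sum_square power_mult_distrib flip: power_mult)
  moreover have "(pairing y (frob_poly h))^2 = (\<Sum>j\<le>degree h. (coeff h j)^4 * (y j)^2)"
    by (simp add: pairing_def sum_square power_mult_distrib flip: power_mult)
  moreover have "pairing y (frob_poly (frob_poly h)) = (\<Sum>j\<le>degree h. (coeff h j)^4 * y j)"
    by (simp add: pairing_def flip: power_mult)
  moreover have "pairing y (pCons 0 (frob_poly (frob_poly h))) = (\<Sum>j\<le>degree h. (coeff h j)^4 * y (Suc j))"
    by (subst pairing_pCons) (simp add: pairing_def flip: power_mult)
  ultimately show ?thesis
    by (simp add: rec sum_distrib_left sum.distrib algebra_simps flip: power_mult)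
qed

end

lemma irreducible_root_degree:
  assumes "irreducible (p :: 'a::field poly)" "poly p c = 0"
  shows "degree p = 1"
proof -
  have "[:- c, 1:] dvd p" using assms(2) by (simp only: poly_eq_0_iff_dvd)
  then obtain k where k: "p = [:- c, 1:] * k" ..
  have "\<not> is_unit [:- c, 1:]" by (simp add: is_unit_iff_degree)
  then have "is_unit k" using assms(1) k by (metis irreducibleD)
  moreover from this have "k \<noteq> 0" by auto
  ultimately have "k \<noteq> 0" "degree k = 0" by (simp_all add: is_unit_iff_degree)
  then show ?thesis unfolding k by (subst degree_mult_eq) auto
qed

section \<open>Eigenvectors and the Galois action on them\<close>

context sep_closure
begin

lemma uminus_eq [simp]: "- (x::'k) = x"
  using add_self[of x] by (simp only: neg_eq_iff_add_eq_0)

lemma pairing_eigenvector_char2: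
  assumes "\<And>q. pairing y (P * q) = 0" "P = [:t, 1:] * h"
  shows "pairing y (h * q) = poly q t * pairing y (h :: 'k poly)"
  using assms by (intro pairing_eigenvector[of y P]) (simp_all only: uminus_eq)

text \<open>Among the divisors of \<open>P\<close> whose multiples are all killed take
  \<open>h\<close> of least degree, and a root \<open>t\<close> of it. Then k = h / (x + t) is an
  eigenvector that is not killed, and passing to P / (x + t) multiplies its pairing by the value of
  P / h at \<open>t\<close>, nonzero by separability.\<close>

lemma separable_eigenvalue:
  fixes P :: "'k poly"
  assumes P: "P \<noteq> 0" "coprime P (pderiv P)" and ann: "\<And>q. pairing y (P * q) = 0" and y0: "y 0 \<noteq> 0"
  obtains t h where "P = [:t, 1:] * h" "pairing y h \<noteq> 0"
proof -
  define Q where "Q = (\<lambda>h. h dvd P \<and> (\<forall>q. pairing y (h * q) = 0))"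
  have "Q P" using ann by (simp add: Q_def)
  then obtain h where h: "Q h" and least: "\<And>k. Q k \<Longrightarrow> degree h \<le> degree k"
    using ex_has_least_nat[of Q P degree] by blast
  have h0: "h \<noteq> 0" using h P(1) by (auto simp: Q_def)
  have "degree h \<ge> 1"
  proof (rule ccontr)
    assume "\<not> degree h \<ge> 1"
    then obtain c where c: "h = [:c:]" by (auto elim!: degree_eq_zeroE simp: not_le)
    then have "h * [:inverse c:] = 1" using h0 by (simp add: one_pCons)
    then have "pairing y 1 = 0" using h unfolding Q_def by metis
    then show False using y0 by (simp add: pairing_def)
  qed
  moreover have "coprime h (pderiv h)" using P(2) h by (auto intro: separable_dvd simp: Q_def)
  ultimately obtain t where t: "poly h t = 0" by (rule separable_root)
  then have "[:- t, 1:] dvd h" by (simp only: poly_eq_0_iff_dvd)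
  then obtain k where k: "h = [:t, 1:] * k" by (auto simp del: mult_pCons_left)
  obtain m where m: "P = h * m" using h by (auto simp: Q_def)
  have k0: "k \<noteq> 0" using h0 k by auto
  have "degree h = Suc (degree k)" unfolding k using k0 by (subst degree_mult_eq) auto
  then have "\<not> Q k" using least[of k] by auto
  moreover have "k dvd P" unfolding m k by (metis dvd_mult dvd_mult2 dvd_refl)
  ultimately obtain q where q: "pairing y (k * q) \<noteq> 0" unfolding Q_def by blast
  have hq: "pairing y (h * x) = 0" for x using h by (simp add: Q_def)
  have eig: "pairing y (k * q) = poly q t * pairing y k" for q
    by (rule pairing_eigenvector_char2[OF hq k])
  have "poly m t \<noteq> 0"
  proof
    assume "poly m t = 0"
    then have "[:- t, 1:] dvd m" by (simp only: poly_eq_0_iff_dvd)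
    then obtain m' where m': "m = [:t, 1:] * m'" by (auto simp del: mult_pCons_left)
    have "[:t, 1:] dvd P" "[:t, 1:] dvd pderiv P"
      unfolding m k m' pderiv_mult by (auto simp del: mult_pCons_left simp: dvd_add)
    then have "is_unit [:t, 1:]" using P(2) by (blast intro: coprime_common_divisor)
    then show False by (auto simp: is_unit_iff_degree)
  qed
  moreover have "pairing y k \<noteq> 0" using eig[of q] q by auto
  ultimately have "pairing y (k * m) \<noteq> 0" using eig[of m] by simp
  moreover have "P = [:t, 1:] * (k * m)" unfolding m k by (simp only: mult.assoc)
  ultimately show ?thesis by (rule that[rotated])
qed

text \<open>\<open>y\<close> is the orbit of a generator under the action of T in the model with
  leading coefficient 1; \<open>ann\<close> says that \<open>p\<close> acts as 0, and
  \<open>gal\<close> that each automorphism acts on the orbit as an element of A.\<close>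

theorem no_galois_stable_sequence:
  fixes p g :: A and y :: "nat \<Rightarrow> 'k"
  assumes irr: "irreducible p" and deg: "degree p \<ge> 2"
    and rec: "\<And>j. y (Suc j) = T * y j + iota (embA g) * (y j)^2 + (y j)^4"
    and ann: "\<And>n. pairing (\<lambda>i. y (i + n)) (bit_hom.hom_poly p) = 0"
    and gal: "\<And>\<sigma>. galois_elem iota \<sigma> \<Longrightarrow>
      \<exists>\<chi>. \<forall>j. \<sigma> (y j) = pairing (\<lambda>i. y (i + j)) (bit_hom.hom_poly \<chi>)"
    and y0: "y 0 \<noteq> 0"
  shows False
proof -
  define P where "P = bit_hom.hom_poly p"
  have p0: "p \<noteq> 0" using irr by auto
  have P0: "P \<noteq> 0" using p0 by (simp add: P_def)
  have frobP: "frob_poly P = P" by (simp add: P_def)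
  have sepP: "coprime P (pderiv P)"
    unfolding P_def by (rule bit_hom.hom_poly_coprime_pderiv[OF irreducible_separable_bit[OF irr] p0])
  have annP: "pairing y (P * q) = 0" for q
    by (simp add: pairing_mult P_def ann)
  obtain t h0 where h0: "P = [:t, 1:] * h0" and r0: "pairing y h0 \<noteq> 0"
    using separable_eigenvalue[OF P0 sepP annP y0] .
  have Pt: "poly P t = 0" by (simp add: h0 del: mult_pCons_left)
  obtain n where n: "n \<ge> 1" "t ^ (2 ^ n) = t" using root_periodic[OF p0] Pt unfolding P_def by blast
  have F2: "t \<noteq> emb_bit c" for c
  proof
    assume "t = emb_bit c"
    then have "poly p c = 0" using Pt by (simp add: P_def bit_hom.poly_hom_poly)
    then show False using irreducible_root_degree[OF irr] deg by simp
  qed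
  have t01: "t \<noteq> 0" "t \<noteq> 1" using F2[of 0] F2[of 1] by auto
  define h1 where "h1 = frob_poly h0"
  define h2 where "h2 = frob_poly h1"
  have h1: "P = [:t^2, 1:] * h1"
    using arg_cong[OF h0, of frob_poly] by (simp add: frobP frob_poly_mult frob_poly_pCons h1_def del: mult_pCons_left)
  have h2: "P = [:(t^2)^2, 1:] * h2"
    using arg_cong[OF h1, of frob_poly] by (simp add: frobP frob_poly_mult frob_poly_pCons h2_def del: mult_pCons_left)
  have eig: "pairing y (h * q) = poly q s * pairing y h" if "P = [:s, 1:] * h" for s h q
    by (rule pairing_eigenvector_char2[OF annP that])
  define r0 r1 r2 where "r0 = pairing y h0" and "r1 = pairing y h1" and "r2 = pairing y h2"
  \<comment> \<open>Multiplication by x acts on the eigenvector \<open>h2\<close> by t^4, while the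
    recurrence evaluates the same shift in terms of \<open>r0\<close>, \<open>r1\<close>,
    \<open>r2\<close>.\<close>
  have "(t^2)^2 * r2 = pairing y (pCons 0 h2)"
    using eig[OF h2, of "[:0, 1:]"] by (simp add: r2_def)
  also have "\<dots> = T * r2 + iota (embA g) * r1^2 + r0^4"
    using pairing_twist[where y = y, OF rec, of h0] unfolding h2_def[symmetric] h1_def[symmetric] r0_def r1_def r2_def .
  finally have "((t^2)^2 + T) * r2 = (T * r2 + T * r2) + (iota (embA g) * r1^2 + r0^4)"
    by (simp only: ring_distribs ac_simps)
  then have "((t^2)^2 + T) * r2 = iota (embA g) * r1^2 + r0^4"
    by (simp only: add_self add_0)
  note main = this
  \<comment> \<open>An automorphism conjugates \<open>h\<close> and multiplies the sequence by
    \<chi>; if the conjugate is an eigenvector for s, then \<chi> acts as the scalar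
    \<chi>(s).\<close>
  have gal_pairing: "\<exists>\<chi>. \<forall>h s. P = [:s, 1:] * map_poly \<sigma> h \<longrightarrow>
      \<sigma> (pairing y h) = poly (bit_hom.hom_poly \<chi>) s * pairing y (map_poly \<sigma> h)"
    if \<sigma>: "galois_elem iota \<sigma>" for \<sigma>
  proof -
    interpret \<sigma>: field_hom \<sigma> using \<sigma> by unfold_locales (simp add: galois_elem_def)
    obtain \<chi> where \<chi>: "\<And>j. \<sigma> (y j) = pairing (\<lambda>i. y (i + j)) (bit_hom.hom_poly \<chi>)"
      using gal[OF \<sigma>] by blast
    show ?thesis
    proof (intro exI allI impI)
      fix h s assume "P = [:s, 1:] * map_poly \<sigma> h"
      have "\<sigma> (pairing y h) = pairing y (map_poly \<sigma> h * bit_hom.hom_poly \<chi>)"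
        by (simp add: \<sigma>.hom_pairing \<chi> pairing_mult[symmetric] mult.commute)
      also have "\<dots> = poly (bit_hom.hom_poly \<chi>) s * pairing y (map_poly \<sigma> h)"
        by (rule eig) fact
      finally show "\<sigma> (pairing y h) = poly (bit_hom.hom_poly \<chi>) s * pairing y (map_poly \<sigma> h)" .
    qed
  qed
  have map_h: "map_poly \<sigma> h0 = h \<and> map_poly \<sigma> h1 = frob_poly h"
    if \<sigma>: "galois_elem iota \<sigma>" and h: "P = [:\<sigma> t, 1:] * h" for \<sigma> h
  proof
    interpret \<sigma>: field_hom \<sigma> using \<sigma> by unfold_locales (simp add: galois_elem_def)
    have "map_poly \<sigma> P = P" using \<sigma>
      by (intro poly_eqI) (simp add: P_def emb_bit_def galois_elem_def)
    then have "[:\<sigma> t, 1:] * map_poly \<sigma> h0 = [:\<sigma> t, 1:] * h"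
      unfolding h[symmetric] by (subst (asm) h0) (simp add: \<sigma>.hom_poly_mult \<sigma>.hom_poly_pCons del: mult_pCons_left)
    moreover have "[:\<sigma> t, 1:] \<noteq> 0" by simp
    ultimately show *: "map_poly \<sigma> h0 = h" using mult_left_cancel by blast
    have "map_poly \<sigma> h1 = frob_poly (map_poly \<sigma> h0)"
      by (rule poly_eqI) (simp add: h1_def \<sigma>.hom_power)
    then show "map_poly \<sigma> h1 = frob_poly h" by (simp add: *)
  qed
  obtain \<sigma>1 where \<sigma>1: "galois_elem iota \<sigma>1" "\<sigma>1 t = t^2"
    using galois_elem_conjugate[OF conjugate_root[OF n(2,1)]] .
  interpret \<sigma>1: field_hom \<sigma>1 using \<sigma>1 by unfold_locales (simp add: galois_elem_def)
  have map1: "map_poly \<sigma>1 h0 = h1" "map_poly \<sigma>1 h1 = h2"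
    using map_h[OF \<sigma>1(1), of h1] h1 by (auto simp: \<sigma>1(2) h2_def)
  obtain \<chi> where \<chi>: "\<And>h s. P = [:s, 1:] * map_poly \<sigma>1 h \<Longrightarrow>
      \<sigma>1 (pairing y h) = poly (bit_hom.hom_poly \<chi>) s * pairing y (map_poly \<sigma>1 h)"
    using gal_pairing[OF \<sigma>1(1)] by blast
  define c where "c = poly (bit_hom.hom_poly \<chi>) (t^2)"
  have s1r0: "\<sigma>1 r0 = c * r1" using \<chi>[of "t^2" h0] h1 by (simp add: map1 c_def r0_def r1_def)
  \<comment> \<open>\<chi> has coefficients in F_2, so its values at t^2 and t^4 differ by a
    squaring; therefore \<open>c\<close> cancels in the image of r1 / r0^2.\<close>
  have "poly (bit_hom.hom_poly \<chi>) ((t^2)^2) = c^2"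
    unfolding c_def by (rule poly_bit_hom_square)
  then have s1r1: "\<sigma>1 r1 = c^2 * r2"
    using \<chi>[of "(t^2)^2" h1] h2 by (simp only: map1 r2_def r1_def)
  have r0nz: "r0 \<noteq> 0" using r0 by (simp add: r0_def)
  then have "\<sigma>1 r0 \<noteq> 0" by simp
  then have "c * r1 \<noteq> 0" by (simp only: s1r0 not_False_eq_True)
  then have c0: "c \<noteq> 0" and r1nz: "r1 \<noteq> 0" by auto
  define q where "q = r1 / r0^2"
  have q0: "q \<noteq> 0" using r0nz r1nz by (simp add: q_def)
  obtain G where G: "q = poly (hom_poly G) t"
  proof (rule fixed_field_simple)
    fix \<sigma> assume \<sigma>: "galois_elem iota \<sigma>" "\<sigma> t = t"
    interpret \<sigma>: field_hom \<sigma> using \<sigma> by unfold_locales (simp add: galois_elem_def)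
    have map: "map_poly \<sigma> h0 = h0" "map_poly \<sigma> h1 = h1"
      using map_h[OF \<sigma>(1), of h0] h0 by (auto simp: \<sigma>(2) h1_def)
    obtain \<psi> where \<psi>: "\<And>h s. P = [:s, 1:] * map_poly \<sigma> h \<Longrightarrow>
        \<sigma> (pairing y h) = poly (bit_hom.hom_poly \<psi>) s * pairing y (map_poly \<sigma> h)"
      using gal_pairing[OF \<sigma>(1)] by blast
    define d where "d = poly (bit_hom.hom_poly \<psi>) t"
    have "\<sigma> r0 = d * r0" using \<psi>[of t h0] h0 by (simp add: map d_def r0_def)
    moreover have "\<sigma> r1 = d^2 * r1"
      using \<psi>[of "t^2" h1] h1 by (simp add: map d_def r1_def poly_bit_hom_square)
    moreover have "d \<noteq> 0" using calculation(1) r0nz \<sigma>.hom_eq_0_iff[of r0] by auto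
    ultimately show "\<sigma> q = q"
      using r0nz by (simp add: q_def \<sigma>.hom_divide \<sigma>.hom_power power_mult_distrib)
  qed
  have q1: "poly (hom_poly G) (t^2) = r2 / r1^2"
  proof -
    have "map_poly \<sigma>1 (hom_poly G) = hom_poly G"
      using \<sigma>1(1) by (intro poly_eqI) (simp add: galois_elem_def)
    then have "poly (hom_poly G) (t^2) = \<sigma>1 q"
      using \<sigma>1.poly_hom_poly[of "hom_poly G" t] by (simp add: G \<sigma>1(2))
    also have "\<dots> = r2 / r1^2"
      using c0 by (simp add: q_def \<sigma>1.hom_divide \<sigma>1.hom_power s1r0 s1r1 power_mult_distrib)
    finally show ?thesis .
  qed
  have eq: "((t^2)^2 + T) * (r2 / r1^2) * q^2 = iota (embA g) * q^2 + 1"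
  proof -
    have "((t^2)^2 + T) * (r2 / r1^2) * q^2 = (((t^2)^2 + T) * r2) / r0^4"
      using r1nz by (simp add: q_def power_divide flip: power_mult)
    also have "\<dots> = iota (embA g) * q^2 + 1"
      unfolding main using r0nz by (simp add: q_def power_divide add_divide_distrib flip: power_mult)
    finally show ?thesis .
  qed
  obtain b H where b: "b \<noteq> 0" and H: "(frob_poly ^^ n) H = H"
    and HT: "iota (embA b) * q = poly H T"
    and HT': "iota (embA b) * (r2 / r1^2) = poly (frob_poly H) T"
    using clear_denominators[OF n(2), of G] unfolding G[symmetric] q1 by blast
  define B where "B = bit_hom.hom_poly b"
  define \<gamma> where "\<gamma> = bit_hom.hom_poly g"
  have fB: "frob_poly B = B" and f\<gamma>: "frob_poly \<gamma> = \<gamma>" by (simp_all add: B_def \<gamma>_def)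
  \<comment> \<open>The cleared equation with T made an indeterminate. Every term has degree three
    in \<open>H\<close> and \<open>B\<close> together, hence the factor b^3 below; the coefficients
    are fixed by the n-th Frobenius power, so vanishing at T gives D = 0.\<close>
  define D where "D = [:(t^2)^2, 1:] * frob_poly H * H^2 + B * (\<gamma> * H^2 + B^2)"
  have "(frob_poly ^^ n) D = D"
  proof -
    have "(frob_poly ^^ n) [:(t^2)^2, 1:] = [:(t^2)^2, 1:]"
    proof -
      have "(frob_poly ^^ n) [:x, 1:] = [:x ^ (2 ^ n), 1:]" for x :: 'k
        by (induction n) (simp_all add: frob_poly_pCons mult.commute flip: power_mult)
      moreover have "((t^2)^2) ^ (2 ^ n) = ((t ^ (2 ^ n))^2)^2" by (simp add: mult.commute flip: power_mult)
      ultimately show ?thesis using n(2) by simp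
    qed
    moreover have "(frob_poly ^^ n) (frob_poly H) = frob_poly H"
      using H by (metis funpow_swap1)
    ultimately show ?thesis
      unfolding D_def power2_eq_square frob_funpow_add frob_funpow_mult H
      by (simp only: frob_funpow_fixed fB f\<gamma>)
  qed
  moreover have "poly D T = 0"
  proof -
    have "poly D T = iota (embA b)^3 * (((t^2)^2 + T) * (r2 / r1^2) * q^2 + (iota (embA g) * q^2 + 1))"
      by (simp add: D_def B_def \<gamma>_def poly_bit_hom_T HT[symmetric] HT'[symmetric] algebra_simps 
          power2_eq_square power3_eq_cube)
    then show ?thesis by (simp only: eq add_self mult_zero_right)
  qed
  ultimately have "D = 0" using T_transcendental n(1) by blast
  then have "[:(t^2)^2, 1:] * frob_poly H * H^2 = frob_poly B * (\<gamma> * H^2 + B^2)"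
    unfolding D_def poly_add_eq_0_iff_eq fB .
  moreover have "H \<noteq> 0" using HT b q0 by auto
  moreover have "t^2 \<noteq> 0" "t^2 \<noteq> 1" using t01 square_inj[of t 1] by auto
  ultimately show False using no_solution[OF f\<gamma>] by blast
qed

end

section \<open>Good reduction at all finite places\<close>

lemma irreducible_prime_poly:
  fixes w :: "'a::field poly"
  assumes "irreducible w"
  shows "w dvd a * b \<longleftrightarrow> w dvd a \<or> w dvd b"
proof
  assume ab: "w dvd a * b"
  show "w dvd a \<or> w dvd b"
  proof (cases "w dvd a")
    case na: False
    have "coprime w a"
    proof (rule coprimeI)
      fix d assume d: "d dvd w" "d dvd a"
      obtain e where e: "w = d * e" using d(1) ..
      show "is_unit d"
      proof (rule ccontr)
        assume "\<not> is_unit d"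
        then have "is_unit e" using irreducibleD[OF assms e] by blast
        then have "w dvd d" using e by (metis dvd_mult_unit_iff dvd_refl)
        then show False using na d(2) dvd_trans by blast
      qed
    qed
    moreover have "w \<noteq> 0" using assms by auto
    ultimately obtain x y where "x * w + y * a = 1" by (rule coprime_poly_bezout)
    then have "b = (x * w + y * a) * b" by simp
    also have "\<dots> = w * (x * b) + y * (a * b)" by (simp add: algebra_simps)
    finally have "w dvd b" using ab by (metis dvd_add dvd_mult dvd_triv_left)
    then show ?thesis ..
  qed simp
qed auto

lemma irreducible_prime_power_poly:
  fixes w :: "'a::field poly"
  assumes "irreducible w" "\<not> w dvd b" "w ^ n dvd a * b"
  shows "w ^ n dvd a"
  using assms(3)
proof (induction n arbitrary: a)
  case (Suc n)
  have "w dvd a * b" using Suc.prems by (auto intro: dvd_trans[rotated])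
  then obtain a' where a': "a = w * a'" using assms by (auto simp: irreducible_prime_poly)
  have "w \<noteq> 0" using assms(1) by auto
  then have "w ^ n dvd a' * b" using Suc.prems by (simp add: a' mult.assoc)
  then have "w ^ n dvd a'" by (rule Suc.IH)
  then show ?case by (simp add: a')
qed simp

lemma irreducible_factor_poly:
  fixes b :: "'a::field poly"
  assumes "degree b \<ge> 1"
  obtains w where "irreducible w" "w dvd b"
proof -
  obtain w where w: "w dvd b" "degree w \<ge> 1" 
      and least: "\<And>v. v dvd b \<Longrightarrow> degree v \<ge> 1 \<Longrightarrow> degree w \<le> degree v"
    using ex_has_least_nat[of "\<lambda>v. v dvd b \<and> degree v \<ge> 1" b degree] assms by auto
  have w0: "w \<noteq> 0" using w(2) by auto
  have "irreducible w"
  proof (rule irreducibleI)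
    show "\<not> is_unit w" using w by (auto simp: is_unit_iff_degree[OF w0])
  next
    fix x y assume xy: "w = x * y"
    have nz: "x \<noteq> 0" "y \<noteq> 0" using xy w0 by auto
    have "degree w = degree x + degree y" using xy nz by (simp add: degree_mult_eq)
    moreover have "degree x \<ge> 1 \<Longrightarrow> degree w \<le> degree x" 
      using least[of x] w(1) by (auto simp: xy intro: dvd_mult_left)
    ultimately have "degree x = 0 \<or> degree y = 0" by linarith
    then show "is_unit x \<or> is_unit y" using nz by (simp add: is_unit_iff_degree)
  qed (rule w0)
  then show ?thesis using w(1) that by blast
qed

lemma irreducible_degree_pos:
  assumes "irreducible (w::'a::field poly)"
  shows "degree w \<ge> 1"
proof -
  have "w \<noteq> 0" "\<not> is_unit w" using assms by (auto simp: irreducible_def)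
  then show ?thesis using is_unit_iff_degree[of w] by linarith
qed

lemma lead_coeff_bit: "w \<noteq> 0 \<Longrightarrow> lead_coeff w = (1::bit)"
  by (cases "lead_coeff w") auto

lemma fract_reduced_at:
  fixes w :: A
  assumes "irreducible w"
  obtains m n where "e = Fract m n" "n \<noteq> 0" "\<not> (w dvd m \<and> w dvd n)"
proof -
  obtain m0 n0 where "e = Fract m0 n0" "n0 \<noteq> 0" by (cases e) auto
  then obtain x where x: "e = Fract (fst x) (snd x)" "snd x \<noteq> 0"
    and least: "\<And>y. e = Fract (fst y) (snd y) \<Longrightarrow> snd y \<noteq> 0 \<Longrightarrow> degree (snd x) \<le> degree (snd y)"
    using ex_has_least_nat[of "\<lambda>x. e = Fract (fst x) (snd x) \<and> snd x \<noteq> 0" "(m0, n0)" "\<lambda>x. degree (snd x)"]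
    by auto
  have "\<not> (w dvd fst x \<and> w dvd snd x)"
  proof
    assume "w dvd fst x \<and> w dvd snd x"
    then obtain m n where mn: "fst x = w * m" "snd x = w * n" by (auto elim!: dvdE)
    have n0: "n \<noteq> 0" "w \<noteq> 0" using mn x(2) by auto
    then have "e = Fract m n" using x mn by (simp add: eq_fract)
    then have "degree (snd x) \<le> degree n" using least[of "(m, n)"] n0 by simp
    then show False using irreducible_degree_pos[OF assms] n0 by (simp add: mn(2) degree_mult_eq)
  qed
  then show ?thesis using that x by blast
qed

text \<open>In a representation with denominator of least degree, integrality at an irreducible
  factor of the denominator makes that factor divide the numerator, so it could be cancelled. The
  denominator is thus a nonzero constant, which over F_2 is 1.\<close>

lemma in_all_Ov_integral:
  assumes "\<And>w. irreducible w \<Longrightarrow> in_Ov w x"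
  obtains a where "x = embA a"
proof -
  obtain m0 n0 where "x = Fract m0 n0" "n0 \<noteq> 0" by (cases x) auto
  then obtain z where z: "x = Fract (fst z) (snd z)" "snd z \<noteq> 0"
    and least: "\<And>y. x = Fract (fst y) (snd y) \<Longrightarrow> snd y \<noteq> 0 \<Longrightarrow> degree (snd z) \<le> degree (snd y)"
    using ex_has_least_nat[of "\<lambda>z. x = Fract (fst z) (snd z) \<and> snd z \<noteq> 0" "(m0, n0)" "\<lambda>z. degree (snd z)"]
    by auto
  have "degree (snd z) = 0"
  proof (rule ccontr)
    assume "degree (snd z) \<noteq> 0"
    then obtain w where w: "irreducible w" "w dvd snd z" using irreducible_factor_poly[of "snd z"] by auto
    obtain a b where ab: "\<not> w dvd b" "x = Fract a b" using assms[OF w(1)] by (auto simp: in_Ov_def)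
    have "b \<noteq> 0" using ab by auto
    then have "fst z * b = a * snd z" using z ab by (simp add: eq_fract)
    then have "w dvd fst z * b" using w(2) by simp
    then have "w dvd fst z" using ab irreducible_prime_poly[OF w(1)] by blast
    then obtain m n where mn: "fst z = w * m" "snd z = w * n" using w(2) by (auto elim!: dvdE)
    have n0: "n \<noteq> 0" "w \<noteq> 0" using mn z(2) by auto
    then have "x = Fract m n" using z mn by (simp add: eq_fract)
    then have "degree (snd z) \<le> degree n" using least[of "(m, n)"] n0 by simp
    then show False using irreducible_degree_pos[OF w(1)] n0 by (simp add: mn(2) degree_mult_eq)
  qed
  then obtain c where "snd z = [:c:]" by (auto elim!: degree_eq_zeroE)
  moreover from this have "c = 1" using z(2) by (cases c) auto
  ultimately have "x = embA (fst z)" using z(1) by (simp add: embA_def one_pCons)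
  then show ?thesis by (rule that)
qed

lemma unit_Ov_cases:
  assumes "unit_Ov w x" "irreducible w"
  obtains a b where "x = Fract a b" "\<not> w dvd a" "\<not> w dvd b"
proof -
  obtain a b a' b' where ab: "\<not> w dvd b" "x = Fract a b" "\<not> w dvd b'" "inverse x = Fract a' b'" and x0: "x \<noteq> 0"
    using assms(1) by (auto simp: unit_Ov_def in_Ov_def)
  have nz: "b \<noteq> 0" "b' \<noteq> 0" using ab by auto
  have "x * inverse x = 1" using x0 by simp
  then have "a * a' = b * b'" unfolding ab(4) using ab(2) nz by (simp add: One_fract_def eq_fract)
  then have "\<not> w dvd a" using irreducible_prime_poly[OF assms(2)] ab(1,3) by (metis dvd_mult2)
  then show ?thesis using that ab by blast
qed

text \<open>The local isomorphism \<open>c\<close> is compared with the global scaling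
  \<open>k\<close> through e = c / k = m / n: g0 = g1 e and d = D1 e^3, where D1 = a / b is a unit
  at \<open>w\<close>.\<close>

lemma good_reduction_local:
  assumes good: "good_reduction_at w g D" and w: "irreducible w" and k: "k \<noteq> 0"
    and gk: "g = g0 * k" and Dk: "D = embA d * k ^ 3"
  obtains a b m n g1 where "\<not> w dvd a" "\<not> w dvd b" "\<not> (w dvd m \<and> w dvd n)" "n \<noteq> 0"
    "d * b * n ^ 3 = a * m ^ 3" "g0 = g1 * Fract m n" "in_Ov w g1"
proof -
  obtain g1 D1 c where c: "c \<noteq> 0" "c * g = g1 * c^2" "c * D = D1 * c^4" "in_Ov w g1" "unit_Ov w D1"
    using good by (auto simp: good_reduction_at_def drinfeld_iso_def)
  define e where "e = c / k"
  have "g = g1 * c" using c(1,2) by (simp add: power2_eq_square)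
  then have g0: "g0 = g1 * e" using k gk by (simp add: e_def field_simps)
  have "c * D = c * (D1 * c^3)" using c(3) by (simp add: power3_eq_cube power4_eq_xxxx mult_ac)
  then have "D = D1 * c^3" using c(1) by simp
  then have d: "embA d = D1 * e^3" using k Dk by (simp add: e_def power_divide field_simps)
  obtain m n where mn: "e = Fract m n" "n \<noteq> 0" "\<not> (w dvd m \<and> w dvd n)"
    using fract_reduced_at[OF w] .
  obtain a b where ab: "D1 = Fract a b" "\<not> w dvd a" "\<not> w dvd b" using unit_Ov_cases[OF c(5) w] .
  have "b \<noteq> 0" using ab by auto
  have "d * b * n^3 = a * m^3"
    using d \<open>b \<noteq> 0\<close> mn(2) unfolding ab(1) mn(1) embA_def
    by (simp add: eq_fract power3_eq_cube mult_ac)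
  then show ?thesis using that ab(2,3) mn(2,3) g0 c(4) mn(1) by blast
qed

text \<open>Isomorphisms change D by cubes. Write D = d k^3 with \<open>d\<close> in A of least
  degree: by good reduction, an irreducible factor of \<open>d\<close> occurs to the third power and
  could be absorbed into \<open>k\<close>. So \<open>d\<close> is a nonzero constant, that is
  1.\<close>

theorem good_reduction_normal_form:
  assumes "\<And>w. irreducible w \<Longrightarrow> good_reduction_at w g D" "D \<noteq> 0"
  obtains c g0 where "c \<noteq> 0" "g = embA g0 * c" "D = c ^ 3"
proof -
  define Q where "Q = (\<lambda>d. d \<noteq> 0 \<and> (\<exists>k. k \<noteq> 0 \<and> D = embA d * k ^ 3))"
  obtain x y where xy: "D = Fract x y" "y \<noteq> 0" by (cases D) auto
  have "Q (x * y^2)"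
  proof -
    \<comment> \<open>A first representation: x / y = x y^2 (1 / y)^3.\<close>
    have "D = embA (x * y^2) * (Fract 1 y)^3"
      using xy by (simp add: embA_def eq_fract power3_eq_cube power2_eq_square mult_ac)
    moreover have "Fract 1 y \<noteq> 0" using xy(2) by (simp add: Zero_fract_def eq_fract)
    moreover have "x \<noteq> 0" using xy assms(2) by (auto simp: Zero_fract_def eq_fract)
    ultimately show ?thesis using xy(2) by (auto simp: Q_def)
  qed
  then obtain d where d: "Q d" and least: "\<And>e. Q e \<Longrightarrow> degree d \<le> degree e"
    using ex_has_least_nat[of Q _ degree] by blast
  obtain k where k: "k \<noteq> 0" "D = embA d * k^3" using d by (auto simp: Q_def)
  define h where "h = g / k"
  have hk: "g = h * k" using k(1) by (simp add: h_def)
  note loc = good_reduction_local[OF assms(1) _ k(1) hk k(2)]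
  have "degree d = 0"
  proof (rule ccontr)
    assume "degree d \<noteq> 0"
    then obtain w where w: "irreducible w" "w dvd d" using irreducible_factor_poly[of d] by auto
    note pr = irreducible_prime_poly[OF w(1)]
    obtain a b m n g1 where *: "\<not> w dvd a" "\<not> w dvd b" "\<not> (w dvd m \<and> w dvd n)" "n \<noteq> 0"
      "d * b * n ^ 3 = a * m ^ 3" "h = g1 * Fract m n" "in_Ov w g1" by (rule loc[OF w(1) w(1)])
    have "w dvd a * m^3" using w(2) *(5) by (metis dvd_mult2)
    \<comment> \<open>Hence \<open>w\<close> does not divide \<open>n\<close>, and the factor w^3 of
      a m^3 must divide \<open>d\<close>.\<close>
    then have wm: "w dvd m" using *(1) by (simp add: pr power3_eq_cube)
    then have "w^3 dvd d * (b * n^3)" using *(5) by (metis dvd_mult dvd_power_same mult.assoc)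
    moreover have "\<not> w dvd b * n^3" using wm *(2,3) by (simp add: pr power3_eq_cube)
    ultimately have "w^3 dvd d" by (rule irreducible_prime_power_poly[OF w(1), rotated])
    then obtain e where e: "d = w^3 * e" ..
    have nz: "w \<noteq> 0" "e \<noteq> 0" using e d w(1) by (auto simp: Q_def)
    have "D = embA e * (embA w * k)^3"
      using k(2) by (simp add: e embA_mult power3_eq_cube)
    then have "Q e" using nz k(1) unfolding Q_def by (metis embA_eq_0_iff mult_eq_0_iff)
    then have "degree d \<le> degree e" by (rule least)
    then show False using nz irreducible_degree_pos[OF w(1)] by (simp add: e degree_mult_eq degree_power_eq)
  qed
  then obtain c where "d = [:c:]" by (auto elim!: degree_eq_zeroE)
  moreover from this have "c = 1" using d by (cases c) (auto simp: Q_def)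
  ultimately have d1: "d = 1" by (simp add: one_pCons)
  obtain g0 where "h = embA g0"
  proof (rule in_all_Ov_integral)
    fix w :: A assume w: "irreducible w"
    note pr = irreducible_prime_poly[OF w]
    obtain a b m n g1 where *: "\<not> w dvd a" "\<not> w dvd b" "\<not> (w dvd m \<and> w dvd n)" "n \<noteq> 0"
      "d * b * n ^ 3 = a * m ^ 3" "h = g1 * Fract m n" "in_Ov w g1" by (rule loc[OF w w])
    \<comment> \<open>Now b n^3 = a m^3, so \<open>w\<close> divides both or neither; m / n being
      reduced at \<open>w\<close>, it divides neither and g1 m / n is integral there.\<close>
    have "w dvd n \<longleftrightarrow> w dvd m"
      using arg_cong[OF *(5), of "\<lambda>z. w dvd z"] *(1,2) by (simp add: d1 pr power3_eq_cube)
    then have wn: "\<not> w dvd n" using *(3) by blast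
    obtain x y where xy: "g1 = Fract x y" "\<not> w dvd y" using *(7) by (auto simp: in_Ov_def)
    have "h = Fract (x * m) (y * n)" using *(6) xy by simp
    moreover have "\<not> w dvd y * n" using wn xy(2) by (simp add: pr)
    ultimately show "in_Ov w h" unfolding in_Ov_def by blast
  qed
  then show ?thesis using that k hk d1 by simp
qed

section \<open>Stable cyclic torsion subgroups\<close>

lemma pairing_scale: "pairing (\<lambda>i. c * y i) h = c * pairing y h"
  by (simp add: pairing_def sum_distrib_left mult.left_commute)

theorem theorem8p10:
  fixes iota :: "F \<Rightarrow> 'k::field" and g D :: F and p :: A
  assumes "separable_closure iota"
    and "irreducible p" and "degree p \<ge> 3"
    and "D \<noteq> 0"
    and "\<forall>w :: A. lead_coeff w = 1 \<and> irreducible w \<longrightarrow> good_reduction_at w g D"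
  shows "\<not> (\<exists>H. cyclic_torsion_subgroup iota g D p H \<and>
                 (\<forall>\<sigma>. galois_elem iota \<sigma> \<longrightarrow> \<sigma> ` H = H))"
proof
  assume "\<exists>H. cyclic_torsion_subgroup iota g D p H \<and> (\<forall>\<sigma>. galois_elem iota \<sigma> \<longrightarrow> \<sigma> ` H = H)"
  then obtain H where H: "cyclic_torsion_subgroup iota g D p H"
    and stable: "\<And>\<sigma>. galois_elem iota \<sigma> \<Longrightarrow> \<sigma> ` H = H" by blast
  obtain f where f_add: "\<And>a b. f (a + b) = f a + f b"
    and f_phi: "\<And>a b. f (a * b) = phi iota g D a (f b)" and f_range: "range f = H"
    and f_ker: "\<And>a. f a = 0 \<longleftrightarrow> p dvd a"
    using H unfolding cyclic_torsion_subgroup_def by blast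
  interpret sep_closure iota by unfold_locales (rule assms(1))
  have "good_reduction_at w g D" if "irreducible w" for w
    using assms(5) that lead_coeff_bit[of w] by (auto simp: irreducible_def)
  then obtain c g0 where c: "c \<noteq> 0" "g = embA g0 * c" "D = c ^ 3"
    using good_reduction_normal_form[of g D] assms(4) by blast
  have f_T: "f (Tvar * b) = phiT iota g D (f b)" for b
    unfolding f_phi by (simp add: phi_def Tvar_def pCons_one)
  have f_const: "f ([:a:] * b) = emb_bit a * f b" for a b
    using f_ker[of 0] by (cases a) (simp_all add: pCons_one)
  have f_mult: "f (a * b) = pairing (\<lambda>i. f (Tvar ^ i * b)) (bit_hom.hom_poly a)" for a b
  proof (induction a arbitrary: b)
    case 0
    show ?case using f_ker[of 0] by simp
  next
    case (pCons x a)
    have "pCons x a * b = [:x:] * b + a * (Tvar * b)" by (simp add: Tvar_def)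
    then have "f (pCons x a * b) = emb_bit x * f b + f (a * (Tvar * b))"
      by (simp only: f_add f_const)
    moreover have "Tvar ^ i * (Tvar * b) = Tvar ^ Suc i * b" for i by (simp add: mult_ac)
    ultimately show ?case
      by (simp only: pCons.IH bit_hom.hom_poly_pCons pairing_pCons power_0 mult_1)
  qed
  \<comment> \<open>Scaling by \<open>c\<close> passes to the isomorphic module with leading
    coefficient 1: c g = g0 c^2 and c D = c^4.\<close>
  define y where "y j = iota c * f (Tvar ^ j)" for j
  have y_pairing: "pairing (\<lambda>i. y (i + j)) (bit_hom.hom_poly a) = iota c * f (a * Tvar ^ j)" for a j
    by (simp only: y_def power_add pairing_scale f_mult[of a "Tvar ^ j"])
  show False
  proof (rule no_galois_stable_sequence[OF assms(2), where y = y and g = g0])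
    show "degree p \<ge> 2" using assms(3) by simp
    show "y (Suc j) = T * y j + iota (embA g0) * (y j)^2 + (y j)^4" for j
    proof -
      have "y (Suc j) = iota c * phiT iota g D (f (Tvar ^ j))"
        by (simp add: y_def f_T)
      then show ?thesis
        by (simp add: phiT_def y_def c(2,3) hom_mult hom_power algebra_simps
            power2_eq_square power3_eq_cube power4_eq_xxxx)
    qed
    show "pairing (\<lambda>i. y (i + n)) (bit_hom.hom_poly p) = 0" for n
      using f_ker[of "p * Tvar ^ n"] by (simp add: y_pairing)
    show "y 0 \<noteq> 0"
      using c(1) f_ker[of 1] irreducible_not_unit[OF assms(2)] by (simp add: y_def)
  next
    fix \<sigma> assume \<sigma>: "galois_elem iota \<sigma>"
    interpret \<sigma>: field_hom \<sigma> using \<sigma> by unfold_locales (simp add: galois_elem_def)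
    have \<sigma>_iota: "\<sigma> (iota x) = iota x" for x using \<sigma> by (simp add: galois_elem_def)
    \<comment> \<open>Stability provides \<chi> for the generator; the action of T has coefficients
      in F and so commutes with \<sigma>, which carries the same \<chi> to the whole orbit.\<close>
    have "\<sigma> (f 1) \<in> H" using stable[OF \<sigma>] f_range by blast
    then obtain \<chi> where \<chi>: "\<sigma> (f 1) = f \<chi>" using f_range by blast
    have "\<sigma> (f (Tvar ^ j)) = f (\<chi> * Tvar ^ j)" for j
    proof (induction j)
      case (Suc j)
      have "\<sigma> (f (Tvar ^ Suc j)) = phiT iota g D (\<sigma> (f (Tvar ^ j)))"
        by (simp add: f_T phiT_def \<sigma>.hom_add \<sigma>.hom_mult \<sigma>.hom_power \<sigma>_iota)
      also have "\<dots> = f (Tvar * (\<chi> * Tvar ^ j))" by (simp add: Suc f_T)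
      finally show ?case by (simp add: mult_ac)
    qed (simp add: \<chi>)
    then have "\<sigma> (y j) = pairing (\<lambda>i. y (i + j)) (bit_hom.hom_poly \<chi>)" for j
      unfolding y_pairing by (simp add: y_def \<sigma>.hom_mult \<sigma>_iota)
    then show "\<exists>\<chi>. \<forall>j. \<sigma> (y j) = pairing (\<lambda>i. y (i + j)) (bit_hom.hom_poly \<chi>)" by blast
  qed
qed

end
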